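(* Let $D$ be a filter on $\kappa$, let $\langle\lambda_i:i<\kappa\rangle$ be a sequence of nonzero cardinals, and let $\theta$ be a cardinal with $\theta\ge\mathrm{reg}_\otimes(D)$. Then $$\Big|\prod_{i<\kappa}\lambda_i/D\Big|\ \le\ \Big(|\theta^\kappa/D|+\mathrm{hcf}_{D,\theta}\big(\prod_{i<\kappa}\lambda_i\big)\Big)^{<\theta}.$$
   Context: $\kappa$ is an infinite cardinal and $D$ is a proper filter on $\kappa$. $D^+=\{A\subseteq\kappa:\kappa\setminus A\notin D\}$; $A_\zeta\subseteq A_\varepsilon\bmod D$ means $\kappa\setminus(A_\zeta\setminus A_\varepsilon)\in D$. $\prod_{i<\kappa}\lambda_i/D$ is the reduced product, and $\theta^\kappa/D$ is the reduced power of $\theta$. $\chi^{<\theta}=\sup\{\chi^\sigma:\sigma<\theta\text{ a cardinal}\}$. $\mathrm{reg}_\otimes(D)$ is the least cardinal $\theta$ for which there are no $A_\varepsilon\in D^+$ ($\varepsilon<\theta$) such that $\varepsilon<\zeta$ implies $A_\zeta\subseteq A_\varepsilon\bmod D$, and no $i<\kappa$ belongs to infinitely many of the $A_\varepsilon$. $\mathrm{hcf}_{D,\mu}(\prod_{i<\kappa}\gamma_i)=\sup\{\mathrm{cf}(\prod_{i}\lambda'_i/D):\ \mu\le\lambda'_i=\mathrm{cf}(\lambda'_i)\le\gamma_i\}$, where coordinates $i$ for which there is no regular cardinal in $[\mu,\gamma_i]$ are ignored: i.e. with $X=\{i<\kappa: [\mu,\gamma_i]$ contains a regular cardinal$\}$,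 the supremum is of $\mathrm{cf}(\prod_{i\in X}\lambda'_i)$ ordered modulo $D+X$ (the filter generated by $D\cup\{X\}$), over all choices of regular $\lambda'_i\in[\mu,\gamma_i]$ ($i\in X$), and it is $0$ if $X\notin D^+$. Here $\mathrm{cf}(P)$ is the least size of a cofinal subset of $P$, the product being ordered by $f\le_D g$ iff $\{i: f(i)\le g(i)\}$ is in the filter. *)

theory Defs
  imports Main "HOL-Library.FuncSet"
begin

unbundle cardinal_syntax

text \<open>
  Cardinals are the library's cardinal orders, compared by \<open>\<le>o\<close>, \<open><o\<close> and \<open>=o\<close>. The infinite
  cardinal \<open>\<kappa>\<close> is the type \<open>'k\<close>, so a filter on \<open>\<kappa>\<close> is an element of the type \<open>'k filter\<close>: membership
  of a set in \<open>D\<close> is \<open>eventually\<close>, membership in \<open>D\<^sup>+\<close> is \<open>frequently\<close>, and the filter generated by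
  \<open>D\<close> and \<open>X\<close> is \<open>inf D (principal X)\<close>.
\<close>

subsection \<open>Minima and suprema of sets of cardinals\<close>

text \<open>Only determined up to \<open>=o\<close>, which is the identity of cardinals.\<close>

definition least_card :: "'a rel set \<Rightarrow> 'a rel" where
  "least_card R = (SOME r. r \<in> R \<and> (\<forall>r'\<in>R. r \<le>o r'))"

lemma least_card:
  assumes "R \<noteq> {}" and "\<And>r. r \<in> R \<Longrightarrow> Card_order r"
  shows "least_card R \<in> R" and "\<And>r. r \<in> R \<Longrightarrow> least_card R \<le>o r"
proof -
  have "\<exists>r. r \<in> R \<and> (\<forall>r'\<in>R. r \<le>o r')"
    using exists_minim_Card_order[of R] assms by blast
  from someI_ex[OF this]
  show "least_card R \<in> R" and "\<And>r. r \<in> R \<Longrightarrow> least_card R \<le>o r"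
    unfolding least_card_def by auto
qed

text \<open>
  Every cardinal order on a subset of \<open>'a\<close> is bounded by \<open>|UNIV :: 'a set|\<close>, so a set of such
  cardinals has its supremum on the same type.
\<close>

definition card_sup :: "'a rel set \<Rightarrow> 'a rel" where
  "card_sup R = least_card {s. Card_order s \<and> (\<forall>r\<in>R. r \<le>o s)}"

lemma card_sup:
  fixes R :: "'a rel set"
  assumes "\<And>r. r \<in> R \<Longrightarrow> Card_order r"
  shows "Card_order (card_sup R)"
    and "\<And>r. r \<in> R \<Longrightarrow> r \<le>o card_sup R"
    and "\<And>s :: 'a rel. Card_order s \<Longrightarrow> (\<And>r. r \<in> R \<Longrightarrow> r \<le>o s) \<Longrightarrow> card_sup R \<le>o s"
proof -
  let ?S = "{s :: 'a rel. Card_order s \<and> (\<forall>r\<in>R. r \<le>o s)}"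
  have "r \<le>o |UNIV :: 'a set|" if "r \<in> R" for r
    using assms[OF that] card_of_Field_ordIso card_of_mono1[of "Field r" UNIV]
      ordIso_ordLeq_trans ordIso_symmetric by blast
  then have "|UNIV| \<in> ?S"
    using card_of_Card_order by blast
  then have ne: "?S \<noteq> {}"
    by blast
  have "card_sup R \<in> ?S"
    unfolding card_sup_def by (rule least_card(1)[OF ne]) simp
  then show "Card_order (card_sup R)" "\<And>r. r \<in> R \<Longrightarrow> r \<le>o card_sup R"
    by auto
  show "card_sup R \<le>o s" if "Card_order s" "\<And>r. r \<in> R \<Longrightarrow> r \<le>o s" for s :: "'a rel"
    unfolding card_sup_def by (rule least_card(2)[OF ne]) (use that in auto)
qed

text \<open>\<open>weak_power \<chi> \<theta>\<close> is \<open>\<chi>\<^bsup><\<theta>\<^esup>\<close>.\<close>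

definition weak_power :: "'b rel \<Rightarrow> 't rel \<Rightarrow> ('t \<Rightarrow> 'b) rel" where
  "weak_power \<chi> \<theta> = card_sup {\<chi> ^c \<sigma> |\<sigma> :: 't rel. Card_order \<sigma> \<and> \<sigma> <o \<theta>}"


subsection \<open>Cofinality\<close>

definition cofinality :: "'p set \<Rightarrow> 'p rel \<Rightarrow> 'p rel" where
  "cofinality P le = least_card {|C| |C. C \<subseteq> P \<and> (\<forall>p\<in>P. \<exists>c\<in>C. (p, c) \<in> le)}"

lemma cofinality:
  assumes "refl_on P le"
  shows "\<exists>C\<subseteq>P. (\<forall>p\<in>P. \<exists>c\<in>C. (p, c) \<in> le) \<and> cofinality P le = |C|"
    and "\<And>C. C \<subseteq> P \<Longrightarrow> (\<forall>p\<in>P. \<exists>c\<in>C. (p, c) \<in> le) \<Longrightarrow> cofinality P le \<le>o |C|"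
proof -
  let ?R = "{|C| |C. C \<subseteq> P \<and> (\<forall>p\<in>P. \<exists>c\<in>C. (p, c) \<in> le)}"
  have "\<forall>p\<in>P. \<exists>c\<in>P. (p, c) \<in> le"
    using assms by (auto simp: refl_on_def)
  then have ne: "?R \<noteq> {}"
    by blast
  have co: "Card_order r" if "r \<in> ?R" for r
    using that card_of_Card_order by blast
  have "cofinality P le \<in> ?R"
    unfolding cofinality_def by (rule least_card(1)[OF ne co])
  then show "\<exists>C\<subseteq>P. (\<forall>p\<in>P. \<exists>c\<in>C. (p, c) \<in> le) \<and> cofinality P le = |C|"
    by blast
  show "cofinality P le \<le>o |C|" if "C \<subseteq> P" "\<forall>p\<in>P. \<exists>c\<in>C. (p, c) \<in> le" for C
    unfolding cofinality_def by (rule least_card(2)[OF ne co]) (use that in auto)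
qed

text \<open>
  The condition \<open>\<lambda> = cf(\<lambda>)\<close>. For infinite cardinals this is the library's \<open>regularCard\<close>; the two
  differ only on finite cardinals, where \<open>regularCard\<close> uses strict cofinality.
\<close>

definition regular_cardinal :: "'a rel \<Rightarrow> bool" where
  "regular_cardinal r \<longleftrightarrow> Card_order r \<and> r =o cofinality (Field r) r"

lemma regular_cardinal_iff_regularCard:
  assumes "Cinfinite r"
  shows "regular_cardinal r \<longleftrightarrow> regularCard r"
proof -
  have inf: "infinite (Field r)" and co: "Card_order r"
    using assms by (auto simp: cinfinite_def)
  then have "Well_order r"
    by (simp add: card_order_on_well_order_on)
  then have refl: "refl_on (Field r) r" and tr: "trans r" and anti: "antisym r"
    by (auto simp: well_order_on_def linear_order_on_def partial_order_on_def preorder_on_def)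
  have cof: "cofinal K r \<longleftrightarrow> (\<forall>p\<in>Field r. \<exists>c\<in>K. (p, c) \<in> r)" if "K \<subseteq> Field r" for K
  proof
    assume K: "\<forall>p\<in>Field r. \<exists>c\<in>K. (p, c) \<in> r"
    show "cofinal K r"
      unfolding cofinal_def
    proof
      fix a assume "a \<in> Field r"
      with infinite_Card_order_limit[OF co inf] obtain b
        where b: "b \<in> Field r" "a \<noteq> b" "(a, b) \<in> r" by blast
      with K obtain c where c: "c \<in> K" "(b, c) \<in> r" by blast
      with b tr anti have "(a, c) \<in> r" "a \<noteq> c"
        by (auto dest: transD antisymD)
      with c show "\<exists>b\<in>K. a \<noteq> b \<and> (a, b) \<in> r" by blast
    qed
  qed (auto simp: cofinal_def)
  show ?thesis
  proof
    assume reg: "regular_cardinal r"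
    show "regularCard r"
      unfolding regularCard_def
    proof (intro allI impI, elim conjE)
      fix K assume K: "K \<subseteq> Field r" "cofinal K r"
      then have "cofinality (Field r) r \<le>o |K|"
        using cofinality(2)[OF refl K(1)] cof[OF K(1)] by blast
      then have "r \<le>o |K|"
        using reg ordIso_ordLeq_trans unfolding regular_cardinal_def by blast
      moreover have "|K| \<le>o r"
        using card_of_mono1[OF K(1)] card_of_Field_ordIso[OF co] ordLeq_ordIso_trans by blast
      ultimately show "|K| =o r"
        by (simp add: ordIso_iff_ordLeq)
    qed
  next
    assume reg: "regularCard r"
    obtain C where C: "C \<subseteq> Field r" "\<forall>p\<in>Field r. \<exists>c\<in>C. (p, c) \<in> r"
      "cofinality (Field r) r = |C|"
      using cofinality(1)[OF refl] by blast
    then have "|C| =o r"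
      using reg cof[OF C(1)] unfolding regularCard_def by blast
    then show "regular_cardinal r"
      using co C(3) ordIso_symmetric unfolding regular_cardinal_def by metis
  qed
qed


subsection \<open>Reduced products\<close>

definition reduced_product :: "'k filter \<Rightarrow> ('k \<Rightarrow> 'a set) \<Rightarrow> ('k \<Rightarrow> 'a) set set" where
  "reduced_product D A =
     (\<Pi>\<^sub>E i\<in>UNIV. A i) //
     {(f, g). f \<in> (\<Pi>\<^sub>E i\<in>UNIV. A i) \<and> g \<in> (\<Pi>\<^sub>E i\<in>UNIV. A i) \<and> (\<forall>\<^sub>F i in D. f i = g i)}"


subsection \<open>The cardinals reg and hcf of a filter\<close>

text \<open>
  The index order \<open>\<epsilon> < \<zeta>\<close> below the cardinal \<open>\<theta>\<close> is the strict part of the cardinal order \<open>\<theta>\<close> itself,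
  which is an initial well-order.
\<close>

definition reg_otimes_seq :: "'k filter \<Rightarrow> 't rel \<Rightarrow> ('t \<Rightarrow> 'k set) \<Rightarrow> bool" where
  "reg_otimes_seq D \<theta> A \<longleftrightarrow>
     (\<forall>\<epsilon>\<in>Field \<theta>. \<exists>\<^sub>F i in D. i \<in> A \<epsilon>) \<and>
     (\<forall>\<epsilon> \<zeta>. (\<epsilon>, \<zeta>) \<in> \<theta> \<and> \<epsilon> \<noteq> \<zeta> \<longrightarrow> (\<forall>\<^sub>F i in D. i \<notin> A \<zeta> - A \<epsilon>)) \<and>
     (\<forall>i. finite {\<epsilon>\<in>Field \<theta>. i \<in> A \<epsilon>})"

text \<open>
  The type \<open>'k set\<close> is large enough: the successor of \<open>|UNIV :: 'k set|\<close> has no such sequence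
  when \<open>'k\<close> is infinite.
\<close>

definition reg_otimes :: "'k filter \<Rightarrow> 'k set rel" where
  "reg_otimes D = least_card {\<theta>. Card_order \<theta> \<and> \<not> (\<exists>A. reg_otimes_seq D \<theta> A)}"

lemma reg_otimes:
  fixes D :: "'k filter"
  assumes inf: "infinite (UNIV :: 'k set)"
  shows "Card_order (reg_otimes D)"
    and "\<not> (\<exists>A. reg_otimes_seq D (reg_otimes D) A)"
    and "\<And>\<theta> :: 'k set rel. Card_order \<theta> \<Longrightarrow> \<not> (\<exists>A. reg_otimes_seq D \<theta> A) \<Longrightarrow> reg_otimes D \<le>o \<theta>"
proof -
  let ?R = "{\<theta> :: 'k set rel. Card_order \<theta> \<and> \<not> (\<exists>A. reg_otimes_seq D \<theta> A)}"
  let ?t = "cardSuc |UNIV :: 'k set|"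
  have lt: "|UNIV :: 'k set| <o ?t" and co: "Card_order ?t"
    by (simp_all add: card_of_Card_order cardSuc_greater cardSuc_Card_order)
  have "\<not> reg_otimes_seq D ?t A" for A
  proof
    assume A: "reg_otimes_seq D ?t A"
    let ?F = "\<lambda>i. {\<epsilon>\<in>Field ?t. i \<in> A \<epsilon>}"
    have "A \<epsilon> \<noteq> {}" if "\<epsilon> \<in> Field ?t" for \<epsilon>
      using A that unfolding reg_otimes_seq_def by (metis empty_iff frequently_ex)
    then have "Field ?t = (\<Union>i\<in>UNIV. ?F i)"
      by blast
    moreover have "|?F i| \<le>o |UNIV :: 'k set|" for i
      using A inf Cfinite_ordLess_Cinfinite[of "|?F i|" "|UNIV :: 'k set|"]
      unfolding reg_otimes_seq_def
      by (simp add: cfinite_def cinfinite_def Field_card_of card_of_card_order_on ordLess_imp_ordLeq)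
    ultimately have "|Field ?t| \<le>o |UNIV :: 'k set|"
      using card_of_UNION_ordLeq_infinite[OF inf, of UNIV ?F]
      by (simp add: ordLeq_refl card_of_Card_order)
    then have "?t \<le>o |UNIV :: 'k set|"
      using card_of_Field_ordIso[OF co] ordIso_ordLeq_trans ordIso_symmetric by blast
    with lt show False
      using not_ordLess_ordLeq by blast
  qed
  with co have ne: "?R \<noteq> {}"
    by blast
  have "reg_otimes D \<in> ?R"
    unfolding reg_otimes_def by (rule least_card(1)[OF ne]) simp
  then show "Card_order (reg_otimes D)" "\<not> (\<exists>A. reg_otimes_seq D (reg_otimes D) A)"
    by auto
  show "reg_otimes D \<le>o \<theta>" if "Card_order \<theta>" "\<not> (\<exists>A. reg_otimes_seq D \<theta> A)" for \<theta> :: "'k set rel"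
    unfolding reg_otimes_def by (rule least_card(2)[OF ne]) (use that in auto)
qed

text \<open>
  A cardinal below \<open>\<gamma> i\<close> is represented on the type \<open>'a\<close> of \<open>\<gamma> i\<close>. Coordinates outside \<open>X\<close> are
  dropped from the product (\<open>\<Pi>\<^sub>E\<close> makes the functions \<open>undefined\<close> there).
\<close>

definition hcf :: "'k filter \<Rightarrow> 't rel \<Rightarrow> ('k \<Rightarrow> 'a rel) \<Rightarrow> ('k \<Rightarrow> 'a) rel" where
  "hcf D \<mu> \<gamma> =
     (let X = {i. \<exists>\<nu> :: 'a rel. regular_cardinal \<nu> \<and> \<mu> \<le>o \<nu> \<and> \<nu> \<le>o \<gamma> i} in
      if \<exists>\<^sub>F i in D. i \<in> X
      then card_sup
        {cofinality (\<Pi>\<^sub>E i\<in>X. Field (\<nu> i))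
           {(f, g). f \<in> (\<Pi>\<^sub>E i\<in>X. Field (\<nu> i)) \<and> g \<in> (\<Pi>\<^sub>E i\<in>X. Field (\<nu> i)) \<and>
              (\<forall>\<^sub>F i in inf D (principal X). (f i, g i) \<in> \<nu> i)}
         |\<nu> :: 'k \<Rightarrow> 'a rel. \<forall>i\<in>X. regular_cardinal (\<nu> i) \<and> \<mu> \<le>o \<nu> i \<and> \<nu> i \<le>o \<gamma> i}
      else czero)"

end

theory Submission
  imports Defs
begin

text \<open>
  Fix \<open>f\<close> in the product. Its class modulo \<open>D\<close> is found by a transfinite search: functions
  \<open>g \<epsilon>\<close> (\<open>\<epsilon> < \<theta>\<close>) are chosen such that, almost everywhere, \<open>g \<epsilon>\<close> is at least \<open>f\<close> and, where it is
  not yet equal to \<open>f\<close>, strictly below every earlier \<open>g \<xi>\<close> that is at least \<open>f\<close> there (\<open>sharpens\<close>). Two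
  facts give the bound.

  The search succeeds before \<open>\<theta>\<close>. If no \<open>g \<epsilon>\<close> were equal to \<open>f\<close> modulo \<open>D\<close>, the sets where \<open>f\<close> is
  strictly below \<open>g \<epsilon>\<close> would be positive and decreasing modulo \<open>D\<close>; and a point belonging to infinitely
  many of them would give an infinite descending sequence in a well-order. Such a sequence of length
  \<open>\<theta>\<close> is excluded by \<open>reg_otimes D \<le>o \<theta>\<close> (\<open>sharpening_terminates\<close>).

  Each step has only \<open>\<chi> = |\<theta>\<^sup>\<kappa>/D| + hcf\<close> outcomes, whatever \<open>f\<close> is (\<open>few_sharpenings\<close>). At
  a coordinate \<open>i\<close>, the part of \<open>\<Lambda> i\<close> in which \<open>f i\<close> is known to lie is cut off by one of at most \<open>\<theta>\<close>
  earlier values, and it has a cofinal subset whose order type is a regular cardinal. If this cardinal is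
  below \<open>\<theta>\<close>, an element of the cofinal subset above \<open>f i\<close> can be named outright, and naming a
  sequence of such choices modulo \<open>D\<close> costs \<open>|\<theta>\<^sup>\<kappa>/D|\<close>. On the remaining coordinates all the
  cofinalities are regular cardinals between \<open>\<theta>\<close> and \<open>\<Lambda> i\<close>, and a cofinal family in their
  product modulo \<open>D\<close> has size at most \<open>hcf\<close>.

  So \<open>f\<close> is determined modulo \<open>D\<close> by fewer than \<open>\<theta>\<close> elements of \<open>\<chi>\<close>
  (\<open>card_of_le_weak_power_if_coded\<close>).
\<close>

section \<open>Regular cofinal subsets of well-orders\<close>

lemma Well_order_facts:
  assumes "Well_order r"
  shows "x \<in> Field r \<Longrightarrow> (x, x) \<in> r"
    and "(x, y) \<in> r \<Longrightarrow> (y, z) \<in> r \<Longrightarrow> (x, z) \<in> r"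
    and "(x, y) \<in> r \<Longrightarrow> (y, x) \<in> r \<Longrightarrow> x = y"
    and "x \<in> Field r \<Longrightarrow> y \<in> Field r \<Longrightarrow> (x, y) \<notin> r \<Longrightarrow> (y, x) \<in> r \<and> x \<noteq> y"
    and "(x, y) \<in> r \<Longrightarrow> x \<in> Field r"
    and "(x, y) \<in> r \<Longrightarrow> y \<in> Field r"
    and "wf (r - Id)"
proof -
  have W: "refl_on (Field r) r" "trans r" "antisym r" "total_on (Field r) r" "wf (r - Id)"
    using assms
    by (auto simp: well_order_on_def linear_order_on_def partial_order_on_def preorder_on_def)
  show "x \<in> Field r \<Longrightarrow> (x, x) \<in> r"
    using W(1) by (rule refl_onD)
  show "(x, y) \<in> r \<Longrightarrow> (y, z) \<in> r \<Longrightarrow> (x, z) \<in> r"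
    using W(2) by (rule transD)
  show "(x, y) \<in> r \<Longrightarrow> (y, x) \<in> r \<Longrightarrow> x = y"
    using W(3) by (rule antisymD)
  show "x \<in> Field r \<Longrightarrow> y \<in> Field r \<Longrightarrow> (x, y) \<notin> r \<Longrightarrow> (y, x) \<in> r \<and> x \<noteq> y"
    using W(1,4) by (metis refl_onD total_on_def)
  show "wf (r - Id)"
    by (rule W(5))
  show "(x, y) \<in> r \<Longrightarrow> x \<in> Field r" "(x, y) \<in> r \<Longrightarrow> y \<in> Field r"
    by (auto simp: Field_def)
qed

lemma Well_order_has_least:
  assumes "Well_order r" and "A \<subseteq> Field r" and "A \<noteq> {}"
  obtains a where "a \<in> A" and "\<And>b. b \<in> A \<Longrightarrow> (a, b) \<in> r"
proof -
  obtain a where a: "a \<in> A" "\<And>y. (y, a) \<in> r - Id \<Longrightarrow> y \<notin> A"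
    using wfE_min'[OF Well_order_facts(7)[OF assms(1)], of A] assms(3) by blast
  have "(a, b) \<in> r" if "b \<in> A" for b
  proof (rule ccontr)
    assume "(a, b) \<notin> r"
    moreover have "a \<in> Field r" "b \<in> Field r"
      using a(1) that assms(2) by auto
    ultimately have "(b, a) \<in> r \<and> a \<noteq> b"
      using Well_order_facts(4)[OF assms(1)] by blast
    with a(2)[of b] that show False by blast
  qed
  with a(1) that show thesis by blast
qed

lemma Field_Restr_Well_order:
  "Well_order r \<Longrightarrow> C \<subseteq> Field r \<Longrightarrow> Field (Restr r C) = C"
  using Well_order_facts(1)[of r] by (fastforce simp: Field_def)

text \<open>
  A cofinal subset of least size contains one whose order type in \<open>r\<close> is its cardinal: enumerate
  the subset in the order of its cardinal and keep the records. The records are still cofinal, so there are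
  equally many of them, and on them the two orders agree. Having the cardinal as a restriction of \<open>r\<close>
  itself makes the inclusion the monotone cofinal map.
\<close>

lemma regular_cofinal_subset:
  assumes r: "Well_order r" and L: "L \<subseteq> Field r"
  obtains C where "C \<subseteq> L" and "\<And>x. x \<in> L \<Longrightarrow> \<exists>c\<in>C. (x, c) \<in> r"
    and "regular_cardinal (Restr r C)"
proof -
  note rf = Well_order_facts[OF r]
  have refl: "refl_on L r"
    using L rf(1) by (auto simp: refl_on_def)
  then obtain K where K: "K \<subseteq> L" "\<And>x. x \<in> L \<Longrightarrow> \<exists>c\<in>K. (x, c) \<in> r" "cofinality L r = |K|"
    using cofinality(1)[OF refl] by (elim exE conjE) blast
  have min: "|K| \<le>o |J|" if "J \<subseteq> L" "\<forall>x\<in>L. \<exists>c\<in>J. (x, c) \<in> r" for J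
    using cofinality(2)[OF refl that] K(3) by simp
  define s where "s = |K|"
  have s: "Well_order s" "Field s = K" "Card_order s"
    unfolding s_def by (rule card_of_Well_order Field_card_of card_of_Card_order)+
  note sf = Well_order_facts[OF s(1)]
  \<comment> \<open>the records: larger in r than everything enumerated before\<close>
  define C where "C = {c \<in> K. \<forall>d. (d, c) \<in> s \<and> d \<noteq> c \<longrightarrow> (d, c) \<in> r}"
  have CL: "C \<subseteq> L" and CK: "C \<subseteq> K" and CF: "C \<subseteq> Field r"
    using K(1) L by (auto simp: C_def)
  have cof: "\<exists>c\<in>C. (x, c) \<in> r" if "x \<in> L" for x
  proof -
    let ?A = "{c \<in> K. (x, c) \<in> r}"
    have A: "?A \<subseteq> Field s" "?A \<noteq> {}"
      using s(2) K(2)[OF that] by auto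
    obtain c where c: "c \<in> ?A" "\<And>b. b \<in> ?A \<Longrightarrow> (c, b) \<in> s"
      by (rule Well_order_has_least[OF s(1) A]) blast
    have "(d, c) \<in> r" if "(d, c) \<in> s" "d \<noteq> c" for d
    proof (rule ccontr)
      assume n: "(d, c) \<notin> r"
      have d: "d \<in> K"
        using sf(5)[OF that(1)] s(2) by simp
      then have "d \<in> Field r" "c \<in> Field r" "(x, c) \<in> r"
        using c(1) K(1) L by auto
      then have "(x, d) \<in> r"
        using n rf(4) rf(2) by metis
      with c(2) d have "(c, d) \<in> s" by simp
      with that sf(3) show False by metis
    qed
    then have "c \<in> C"
      using c(1) by (auto simp: C_def)
    with c(1) show ?thesis by blast
  qed
  let ?n = "Restr r C"
  have n_eq: "?n = Restr s C"
  proof -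
    have "(d, c) \<in> r \<longleftrightarrow> (d, c) \<in> s" if "d \<in> C" "c \<in> C" for c d
    proof (cases "d = c")
      case True
      have "c \<in> Field r" "c \<in> Field s"
        using that CF CK s(2) by auto
      then show ?thesis
        using rf(1) sf(1) True by simp
    next
      case False
      have "(d, c) \<in> s \<Longrightarrow> (d, c) \<in> r" "(c, d) \<in> s \<Longrightarrow> (c, d) \<in> r"
        using that False by (auto simp: C_def)
      moreover have "(d, c) \<in> s \<or> (c, d) \<in> s"
        using sf(4)[of d c] that CK s(2) by auto
      ultimately show ?thesis
        using rf(3) False by metis
    qed
    then show ?thesis by auto
  qed
  have F: "Field ?n = C"
    by (rule Field_Restr_Well_order[OF r CF])
  have W: "Well_order ?n"
    by (rule Well_order_Restr[OF r])
  have KC: "|K| \<le>o |C|"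
    using min[OF CL] cof by blast
  have "Restr ?n (underS ?n a) <o |Field ?n|" if "a \<in> Field ?n" for a
  proof -
    let ?u = "underS ?n a"
    have "a \<in> Field s"
      using that F CK s(2) by auto
    then have "|underS s a| <o s"
      using card_of_underS[OF s(3)] by blast
    moreover have "|?u| \<le>o |underS s a|"
      by (rule card_of_mono1) (auto simp: n_eq underS_def)
    ultimately have lt: "|?u| <o |C|"
      using KC unfolding s_def
      by (meson ordLeq_ordLess_trans ordLess_ordLeq_trans)
    show ?thesis
    proof (rule ccontr)
      assume "\<not> ?thesis"
      then have "|C| \<le>o Restr ?n ?u"
        using not_ordLess_iff_ordLeq Well_order_Restr[OF W] F card_of_Well_order by metis
      then have "|Field |C| | \<le>o |Field (Restr ?n ?u)|"
        by (rule card_of_mono2)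
      moreover have "|Field (Restr ?n ?u)| \<le>o |?u|"
        by (rule card_of_mono1) (rule Field_Restr_subset)
      ultimately have "|C| \<le>o |?u|"
        by (simp add: Field_card_of) (blast intro: ordLeq_transitive)
      with lt show False
        using not_ordLess_ordLeq by blast
    qed
  qed
  then have card: "Card_order ?n"
    using Card_order_iff_Restr_underS[OF W] by blast
  have nC: "?n =o |C|"
    using card_of_Field_ordIso[OF card] F ordIso_symmetric by metis
  have refln: "refl_on (Field ?n) ?n"
    unfolding refl_on_def F using rf(1) CF by blast
  obtain J where J: "J \<subseteq> C" "\<forall>p\<in>C. \<exists>c\<in>J. (p, c) \<in> ?n" "cofinality (Field ?n) ?n = |J|"
    using cofinality(1)[OF refln] F by auto
  have "|K| \<le>o |J|"
  proof (rule min)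
    show "\<forall>x\<in>L. \<exists>c\<in>J. (x, c) \<in> r"
    proof
      fix x assume "x \<in> L"
      then obtain c where c: "c \<in> C" "(x, c) \<in> r"
        using cof by metis
      then obtain d where "d \<in> J" "(c, d) \<in> r"
        using J(2) by blast
      with c(2) show "\<exists>c\<in>J. (x, c) \<in> r"
        using rf(2) by metis
    qed
  qed (use J(1) CL in blast)
  moreover have "|C| \<le>o |K|" "|J| \<le>o |C|"
    using CK J(1) by (auto intro: card_of_mono1)
  ultimately have "|C| =o |J|"
    by (meson ordIso_iff_ordLeq ordLeq_transitive)
  with nC have "?n =o |J|"
    by (rule ordIso_transitive)
  then have "regular_cardinal ?n"
    using card J(3) by (simp add: regular_cardinal_def)
  with CL cof that show thesis by blast
qed

text \<open>
  The options for one coordinate. \<open>B\<close> holds the values of the earlier functions at this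
  coordinate, and the set \<open>Q\<close> says in which way an upper bound of \<open>x\<close> is going to be chosen: a singleton
  names the bound, while in the other sets the bound still has to be taken from a cofinal family. The
  quantifier over all \<open>c\<close> beyond \<open>p\<close> is there because such a family dominates \<open>p\<close> without
  reaching it exactly.
\<close>

lemma regular_or_singleton_family:
  fixes r :: "'a rel" and \<theta> :: "'t rel"
  assumes r: "Card_order r" and \<theta>: "Cinfinite \<theta>" and B: "|B| \<le>o \<theta>"
  obtains \<Q> :: "'a set set" where "|\<Q>| \<le>o \<theta>"
    and "\<And>Q. Q \<in> \<Q> \<Longrightarrow> Q \<subseteq> Field r"
    and "\<And>Q. Q \<in> \<Q> \<Longrightarrow> is_singleton Q \<or> regular_cardinal (Restr r Q) \<and> \<theta> \<le>o Restr r Q"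
    and "\<And>x. x \<in> Field r \<Longrightarrow> \<exists>Q\<in>\<Q>. \<exists>p\<in>Q. \<forall>c\<in>Q. (p, c) \<in> r \<longrightarrow>
      (x, c) \<in> r \<and> (x = c \<or> (\<forall>b\<in>B. (x, b) \<in> r \<longrightarrow> (c, b) \<in> r \<and> c \<noteq> b))"
proof -
  have W: "Well_order r"
    using r by (rule card_order_on_well_order_on)
  note rf = Well_order_facts[OF W]
  have "\<exists>C. C \<subseteq> L \<and> (\<forall>x\<in>L. \<exists>c\<in>C. (x, c) \<in> r) \<and> regular_cardinal (Restr r C)"
    if "L \<subseteq> Field r" for L
    by (rule regular_cofinal_subset[OF W that]) blast
  then obtain C where C: "\<And>L. L \<subseteq> Field r \<Longrightarrow> C L \<subseteq> L"
    "\<And>L x. L \<subseteq> Field r \<Longrightarrow> x \<in> L \<Longrightarrow> \<exists>c\<in>C L. (x, c) \<in> r"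
    "\<And>L. L \<subseteq> Field r \<Longrightarrow> regular_cardinal (Restr r (C L))"
    by metis
  \<comment> \<open>the least element of B above x determines one of these initial segments as the place of x\<close>
  define \<L> where "\<L> = insert (Field r) (underS r ` B)"
  have \<L>F: "L \<subseteq> Field r" if "L \<in> \<L>" for L
    using that rf(5) by (auto simp: \<L>_def underS_def)
  define \<S> where "\<S> = {L \<in> \<L>. |C L| <o \<theta>}"
  define V where "V = (B \<inter> Field r) \<union> (\<Union>L\<in>\<S>. C L)"
  \<comment> \<open>cofinal sets smaller than \<open>\<theta>\<close> are split into their points\<close>
  define \<Q> where "\<Q> = (\<lambda>v. {v}) ` V \<union> C ` (\<L> - \<S>)"
  have one: "|{x}| \<le>o \<theta>" for x :: "'a set"
    using \<theta> by (simp add: Cfinite_ordLess_Cinfinite cfinite_def Field_card_of card_of_card_order_on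
        ordLess_imp_ordLeq)
  have "|underS r ` B| \<le>o \<theta>"
    using card_of_image B by (rule ordLeq_transitive)
  then have \<L>\<theta>: "|\<L>| \<le>o \<theta>"
    unfolding \<L>_def using Un_Cinfinite_bound[OF one _ \<theta>] by (metis insert_is_Un)
  have "|\<S>| \<le>o \<theta>"
    using card_of_mono1[of \<S> \<L>] \<L>\<theta> unfolding \<S>_def by (auto intro: ordLeq_transitive)
  moreover have "\<forall>L\<in>\<S>. |C L| \<le>o \<theta>"
    by (auto simp: \<S>_def intro: ordLess_imp_ordLeq)
  ultimately have "|\<Union>L\<in>\<S>. C L| \<le>o \<theta>"
    using \<theta> by (rule UNION_Cinfinite_bound)
  moreover have "|B \<inter> Field r| \<le>o \<theta>"
    using card_of_mono1[of "B \<inter> Field r" B] B by (auto intro: ordLeq_transitive)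
  ultimately have "|V| \<le>o \<theta>"
    unfolding V_def using \<theta> by (metis Un_Cinfinite_bound)
  then have "|(\<lambda>v. {v}) ` V| \<le>o \<theta>"
    by (rule ordLeq_transitive[OF card_of_image])
  moreover have "|\<L> - \<S>| \<le>o \<theta>"
    using card_of_mono1[of "\<L> - \<S>" \<L>] \<L>\<theta> by (auto intro: ordLeq_transitive)
  then have "|C ` (\<L> - \<S>)| \<le>o \<theta>"
    by (rule ordLeq_transitive[OF card_of_image])
  ultimately have \<Q>\<theta>: "|\<Q>| \<le>o \<theta>"
    unfolding \<Q>_def using \<theta> by (metis Un_Cinfinite_bound)
  have sub: "Q \<subseteq> Field r" if "Q \<in> \<Q>" for Q
  proof -
    have "C L \<subseteq> Field r" if "L \<in> \<L>" for L
      by (rule subset_trans[OF C(1)[OF \<L>F[OF that]] \<L>F[OF that]])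
    then show ?thesis
      using that by (auto simp: \<Q>_def V_def \<S>_def)
  qed
  have reg: "is_singleton Q \<or> regular_cardinal (Restr r Q) \<and> \<theta> \<le>o Restr r Q" if "Q \<in> \<Q>" for Q
  proof (cases "Q \<in> (\<lambda>v. {v}) ` V")
    case False
    then have "Q \<in> C ` (\<L> - \<S>)"
      using that unfolding \<Q>_def by blast
    then obtain L where L: "L \<in> \<L>" "\<not> |C L| <o \<theta>" "Q = C L"
      unfolding \<S>_def by blast
    have R: "regular_cardinal (Restr r Q)"
      using C(3)[OF \<L>F[OF L(1)]] L(3) by simp
    then have "Card_order (Restr r Q)"
      by (simp add: regular_cardinal_def)
    from card_of_Field_ordIso[OF this] have "|Q| =o Restr r Q"
      using Field_Restr_Well_order[OF W sub[OF that]] by simp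
    moreover have "\<theta> \<le>o |Q|"
      using not_ordLess_iff_ordLeq[OF card_order_on_well_order_on[OF conjunct2[OF \<theta>]] card_of_Well_order[of "C L"]]
        L(2,3) by simp
    ultimately show ?thesis
      using R by (blast intro: ordLeq_ordIso_trans)
  qed auto
  have guess: "\<exists>Q\<in>\<Q>. \<exists>p\<in>Q. \<forall>c\<in>Q. (p, c) \<in> r \<longrightarrow>
      (x, c) \<in> r \<and> (x = c \<or> (\<forall>b\<in>B. (x, b) \<in> r \<longrightarrow> (c, b) \<in> r \<and> c \<noteq> b))"
    if x: "x \<in> Field r" for x
  proof (cases "x \<in> B")
    case True
    \<comment> \<open>nothing at least x lies strictly below x, so x itself has to be hit\<close>
    then have "{x} \<in> \<Q>"
      using x by (auto simp: \<Q>_def V_def)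
    then show ?thesis
      using rf(1)[OF x] by blast
  next
    case False
    obtain L where L: "L \<in> \<L>" "x \<in> L"
      "\<And>c b. c \<in> L \<Longrightarrow> b \<in> B \<Longrightarrow> (x, b) \<in> r \<Longrightarrow> (c, b) \<in> r \<and> c \<noteq> b"
    proof (cases "{b \<in> B. (x, b) \<in> r} = {}")
      case True
      then show ?thesis
        using that[of "Field r"] x by (auto simp: \<L>_def)
    next
      case ne: False
      have sub: "{b \<in> B. (x, b) \<in> r} \<subseteq> Field r"
        using rf(6) by auto
      obtain b0 where b0: "b0 \<in> {b \<in> B. (x, b) \<in> r}"
        "\<And>b. b \<in> {b \<in> B. (x, b) \<in> r} \<Longrightarrow> (b0, b) \<in> r"
        by (rule Well_order_has_least[OF W sub ne]) blast
      have "x \<noteq> b0"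
        using b0(1) False by auto
      then have "x \<in> underS r b0" "underS r b0 \<in> \<L>"
        using b0(1) by (auto simp: underS_def \<L>_def)
      moreover have "(c, b) \<in> r \<and> c \<noteq> b" if "c \<in> underS r b0" "b \<in> B" "(x, b) \<in> r" for b c
      proof -
        have "(c, b0) \<in> r" "c \<noteq> b0" "(b0, b) \<in> r"
          using that b0(2) by (auto simp: underS_def)
        then show ?thesis
          using rf(2,3) by metis
      qed
      ultimately show ?thesis
        using that by blast
    qed
    obtain p where p: "p \<in> C L" "(x, p) \<in> r"
      using C(2)[OF \<L>F[OF L(1)] L(2)] by blast
    have CL: "C L \<subseteq> L"
      by (rule C(1)[OF \<L>F[OF L(1)]])
    have good: "(x, c) \<in> r \<and> (x = c \<or> (\<forall>b\<in>B. (x, b) \<in> r \<longrightarrow> (c, b) \<in> r \<and> c \<noteq> b))"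
      if "c \<in> C L" "(p, c) \<in> r" for c
    proof -
      have "(x, c) \<in> r"
        using p(2) that(2) by (rule rf(2))
      then show ?thesis
        using L(3) CL that(1) by blast
    qed
    show ?thesis
    proof (cases "L \<in> \<S>")
      case True
      then have "{p} \<in> \<Q>"
        using p(1) by (auto simp: \<Q>_def V_def)
      moreover have "\<forall>c\<in>{p}. (p, c) \<in> r \<longrightarrow>
          (x, c) \<in> r \<and> (x = c \<or> (\<forall>b\<in>B. (x, b) \<in> r \<longrightarrow> (c, b) \<in> r \<and> c \<noteq> b))"
        using good[OF p(1)] by simp
      ultimately show ?thesis
        by (intro bexI[of _ "{p}"] bexI[of _ p]) simp_all
    next
      case False
      then have "C L \<in> \<Q>"
        unfolding \<Q>_def using L(1) by (intro UnI2 imageI DiffI)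
      moreover have "\<forall>c\<in>C L. (p, c) \<in> r \<longrightarrow>
          (x, c) \<in> r \<and> (x = c \<or> (\<forall>b\<in>B. (x, b) \<in> r \<longrightarrow> (c, b) \<in> r \<and> c \<noteq> b))"
        by (intro ballI impI) (rule good)
      ultimately show ?thesis
        using p(1) by (intro bexI[of _ "C L"] bexI[of _ p])
    qed
  qed
  show thesis
    using \<Q>\<theta> sub reg guess by (rule that)
qed

section \<open>Sizes of reduced products\<close>

text \<open>
  Together with the next lemma, this replaces sizes of quotients by sizes of sets of pairwise
  inequivalent functions.
\<close>

lemma card_of_inequivalent_le_reduced_product:
  assumes R: "\<And>f i. f \<in> R \<Longrightarrow> f i \<in> A i"
    and ne: "\<And>f g. f \<in> R \<Longrightarrow> g \<in> R \<Longrightarrow> \<forall>\<^sub>F i in D. f i = g i \<Longrightarrow> f = g"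
  shows "|R| \<le>o |reduced_product D A|"
proof -
  let ?E = "{(f, g). f \<in> (\<Pi>\<^sub>E i\<in>UNIV. A i) \<and> g \<in> (\<Pi>\<^sub>E i\<in>UNIV. A i) \<and> (\<forall>\<^sub>F i in D. f i = g i)}"
  have P: "f \<in> (\<Pi>\<^sub>E i\<in>UNIV. A i)" if "f \<in> R" for f
    using R[OF that] by auto
  have "inj_on (\<lambda>f. ?E `` {f}) R"
  proof (rule inj_onI)
    fix f g assume fg: "f \<in> R" "g \<in> R" "?E `` {f} = ?E `` {g}"
    have "g \<in> ?E `` {g}"
      using P[OF fg(2)] by simp
    then have "g \<in> ?E `` {f}"
      using fg(3) by simp
    then have "\<forall>\<^sub>F i in D. f i = g i" by simp
    with ne fg show "f = g" by blast
  qed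
  moreover have "(\<lambda>f. ?E `` {f}) ` R \<subseteq> reduced_product D A"
    unfolding reduced_product_def by (rule image_subsetI) (rule quotientI, erule P)
  ultimately show ?thesis
    by (meson card_of_ordLeqI image_subset_iff)
qed

lemma reduced_product_representatives:
  obtains R where "\<And>f i. f \<in> R \<Longrightarrow> f i \<in> A i"
    and "\<And>f g. f \<in> R \<Longrightarrow> g \<in> R \<Longrightarrow> \<forall>\<^sub>F i in D. f i = g i \<Longrightarrow> f = g"
    and "\<And>f. (\<And>i. f i \<in> A i) \<Longrightarrow> \<exists>g\<in>R. \<forall>\<^sub>F i in D. f i = g i"
    and "|reduced_product D A| \<le>o |R|"
proof -
  define P where "P = (\<Pi>\<^sub>E i\<in>UNIV. A i)"
  define E where "E = {(f, g). f \<in> P \<and> g \<in> P \<and> (\<forall>\<^sub>F i in D. f i = g i)}"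
  have eq: "equiv P E"
  proof (rule equivI)
    show "E \<subseteq> P \<times> P" "refl_on P E"
      by (auto simp: refl_on_def E_def)
    show "sym E"
      by (rule symI) (auto simp: E_def elim: eventually_mono)
    show "trans E"
    proof (rule transI)
      fix f g h assume "(f, g) \<in> E" "(g, h) \<in> E"
      then show "(f, h) \<in> E"
        by (auto simp: E_def elim: eventually_elim2)
    qed
  qed
  define rep where "rep K = (SOME f. f \<in> K)" for K :: "('a \<Rightarrow> 'b) set"
  have rep: "rep K \<in> K" if "K \<in> P // E" for K
    unfolding rep_def using in_quotient_imp_non_empty[OF eq that] by (simp add: some_in_eq)
  have repP: "rep K \<in> P" if "K \<in> P // E" for K
    using rep[OF that] in_quotient_imp_subset[OF eq that] by blast
  have red: "reduced_product D A = P // E"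
    by (simp add: reduced_product_def P_def E_def)
  have inj: "K = K'" if "K \<in> P // E" "K' \<in> P // E" "\<forall>\<^sub>F i in D. rep K i = rep K' i" for K K'
  proof -
    have "(rep K, rep K') \<in> E"
      using that repP by (simp add: E_def)
    then show ?thesis
      using quotient_eqI[OF eq that(1,2) rep rep] that by blast
  qed
  show thesis
  proof (rule that[of "rep ` (P // E)"])
    show "f i \<in> A i" if "f \<in> rep ` (P // E)" for f i
      using that repP by (force simp: P_def)
    show "f = g" if "f \<in> rep ` (P // E)" "g \<in> rep ` (P // E)" "\<forall>\<^sub>F i in D. f i = g i" for f g
      using that inj by blast
    show "\<exists>g\<in>rep ` (P // E). \<forall>\<^sub>F i in D. f i = g i" if "\<And>i. f i \<in> A i" for f
    proof -
      have "f \<in> P"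
        using that by (auto simp: P_def)
      then have K: "E `` {f} \<in> P // E"
        by (rule quotientI)
      from rep[OF K] have "(f, rep (E `` {f})) \<in> E"
        by blast
      then have "\<forall>\<^sub>F i in D. f i = rep (E `` {f}) i"
        unfolding E_def by blast
      with K show ?thesis by blast
    qed
    have "inj_on rep (P // E)"
      by (rule inj_onI) (use inj in simp)
    then show "|reduced_product D A| \<le>o |rep ` (P // E)|"
      unfolding red by (rule card_of_ordLeqI) simp
  qed
qed

lemma reduced_product_mono:
  assumes "\<And>i. |A i| \<le>o |B i|"
  shows "|reduced_product D A| \<le>o |reduced_product D B|"
proof -
  have "\<exists>j. inj_on j (A i) \<and> j ` A i \<subseteq> B i" for i
    using assms card_of_ordLeq[of "A i" "B i"] by blast
  then obtain j where j: "inj_on (j i) (A i)" "j i ` A i \<subseteq> B i" for i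
    by metis
  obtain R where R: "\<And>f i. f \<in> R \<Longrightarrow> f i \<in> A i"
    "\<And>f g. f \<in> R \<Longrightarrow> g \<in> R \<Longrightarrow> \<forall>\<^sub>F i in D. f i = g i \<Longrightarrow> f = g"
    "\<And>f. (\<And>i. f i \<in> A i) \<Longrightarrow> \<exists>g\<in>R. \<forall>\<^sub>F i in D. f i = g i"
    "|reduced_product D A| \<le>o |R|"
    by (rule reduced_product_representatives[of A D]) blast
  let ?J = "\<lambda>f i. j i (f i)"
  have eq: "f = g" if "f \<in> R" "g \<in> R" "\<forall>\<^sub>F i in D. ?J f i = ?J g i" for f g
  proof -
    have "\<forall>\<^sub>F i in D. f i = g i"
      using that(3)
    proof eventually_elim
      case (elim i)
      then show ?case
        by (rule inj_onD[OF j(1) _ R(1)[OF that(1)] R(1)[OF that(2)]])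
    qed
    with R(2) that show ?thesis by blast
  qed
  have "inj_on ?J R"
  proof (rule inj_onI)
    fix f g assume fg: "f \<in> R" "g \<in> R" "?J f = ?J g"
    show "f = g"
      by (rule eq[OF fg(1,2)]) (simp add: fun_cong[OF fg(3)])
  qed
  then have "|R| \<le>o |?J ` R|"
    by (rule card_of_ordLeqI) simp
  also have "|?J ` R| \<le>o |reduced_product D B|"
  proof (rule card_of_inequivalent_le_reduced_product)
    show "f i \<in> B i" if "f \<in> ?J ` R" for f i
      using that R(1) j(2) by blast
    show "f = g" if "f \<in> ?J ` R" "g \<in> ?J ` R" "\<forall>\<^sub>F i in D. f i = g i" for f g
      using that eq by blast
  qed
  finally (ordLeq_transitive) have "|R| \<le>o |reduced_product D B|" .
  with R(4) show ?thesis by (rule ordLeq_transitive)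
qed

lemma le_reduced_power:
  fixes D :: "'k filter"
  assumes "D \<noteq> bot"
  shows "|B| \<le>o |reduced_product D (\<lambda>i. B)|"
proof -
  let ?c = "\<lambda>b (i :: 'k). b"
  have "inj_on ?c B"
    by (rule inj_onI) metis
  then have "|B| \<le>o |?c ` B|"
    by (rule card_of_ordLeqI) simp
  also have "|?c ` B| \<le>o |reduced_product D (\<lambda>i. B)|"
    by (rule card_of_inequivalent_le_reduced_product) (use assms in \<open>auto\<close>)
  finally (ordLeq_transitive) show ?thesis .
qed

section \<open>Cofinal families from hcf\<close>

text \<open>
  The preorder of the reduced product occurring in the definition of \<open>hcf\<close>.
\<close>

definition product_mod :: "'k filter \<Rightarrow> 'k set \<Rightarrow> ('k \<Rightarrow> 'a rel) \<Rightarrow> ('k \<Rightarrow> 'a) rel" where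
  "product_mod D X \<nu> = {(f, g). f \<in> (\<Pi>\<^sub>E i\<in>X. Field (\<nu> i)) \<and> g \<in> (\<Pi>\<^sub>E i\<in>X. Field (\<nu> i)) \<and>
     (\<forall>\<^sub>F i in inf D (principal X). (f i, g i) \<in> \<nu> i)}"

lemma refl_on_product_mod:
  assumes "\<And>i. i \<in> X \<Longrightarrow> Well_order (\<nu> i)"
  shows "refl_on (\<Pi>\<^sub>E i\<in>X. Field (\<nu> i)) (product_mod D X \<nu>)"
proof -
  have "(f i, f i) \<in> \<nu> i" if "f \<in> (\<Pi>\<^sub>E i\<in>X. Field (\<nu> i))" "i \<in> X" for f i
    using Well_order_facts(1)[OF assms[OF that(2)]] that by auto
  then show ?thesis
    by (auto simp: refl_on_def product_mod_def eventually_inf_principal)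
qed

lemma hcf_eq:
  fixes D :: "'k filter" and \<theta> :: "'t rel" and \<gamma> :: "'k \<Rightarrow> 'a rel"
  defines "X \<equiv> {i. \<exists>\<nu> :: 'a rel. regular_cardinal \<nu> \<and> \<theta> \<le>o \<nu> \<and> \<nu> \<le>o \<gamma> i}"
  shows "hcf D \<theta> \<gamma> = (if \<exists>\<^sub>F i in D. i \<in> X
    then card_sup {cofinality (\<Pi>\<^sub>E i\<in>X. Field (\<nu> i)) (product_mod D X \<nu>) |\<nu>.
      \<forall>i\<in>X. regular_cardinal (\<nu> i) \<and> \<theta> \<le>o \<nu> i \<and> \<nu> i \<le>o \<gamma> i}
    else czero)"
  unfolding hcf_def Let_def X_def product_mod_def by (rule refl)

lemma Card_order_cofinality_product_mod:
  assumes "\<forall>i\<in>X. regular_cardinal (\<nu> i) \<and> P i"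
  shows "Card_order (cofinality (\<Pi>\<^sub>E i\<in>X. Field (\<nu> i)) (product_mod D X \<nu>))"
proof -
  have "Well_order (\<nu> i)" if "i \<in> X" for i
    using assms that by (auto simp: regular_cardinal_def card_order_on_well_order_on)
  then have "refl_on (\<Pi>\<^sub>E i\<in>X. Field (\<nu> i)) (product_mod D X \<nu>)"
    by (rule refl_on_product_mod)
  from cofinality(1)[OF this] show ?thesis
    using card_of_Card_order by auto
qed

lemma Card_order_hcf: "Card_order (hcf D \<theta> \<gamma>)"
proof -
  have zero: "Card_order czero"
    unfolding czero_def by (rule card_of_Card_order)
  show ?thesis
    unfolding hcf_eq by (auto simp: zero intro!: card_sup(1) Card_order_cofinality_product_mod)
qed

lemma cofinal_family_le_hcf:
  fixes D :: "'k filter" and \<theta> :: "'t rel" and \<gamma> \<nu> :: "'k \<Rightarrow> 'a rel"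
  defines "X \<equiv> {i. \<exists>\<nu> :: 'a rel. regular_cardinal \<nu> \<and> \<theta> \<le>o \<nu> \<and> \<nu> \<le>o \<gamma> i}"
  assumes X: "\<exists>\<^sub>F i in D. i \<in> X"
    and \<nu>: "\<And>i. i \<in> X \<Longrightarrow> regular_cardinal (\<nu> i) \<and> \<theta> \<le>o \<nu> i \<and> \<nu> i \<le>o \<gamma> i"
  obtains C where "C \<subseteq> (\<Pi>\<^sub>E i\<in>X. Field (\<nu> i))" and "|C| \<le>o hcf D \<theta> \<gamma>"
    and "\<And>p. p \<in> (\<Pi>\<^sub>E i\<in>X. Field (\<nu> i)) \<Longrightarrow>
      \<exists>c\<in>C. \<forall>\<^sub>F i in D. i \<in> X \<longrightarrow> (p i, c i) \<in> \<nu> i"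
proof -
  define P where "P = (\<Pi>\<^sub>E i\<in>X. Field (\<nu> i))"
  have "Well_order (\<nu> i)" if "i \<in> X" for i
    using \<nu>[OF that] by (auto simp: regular_cardinal_def card_order_on_well_order_on)
  then have "refl_on P (product_mod D X \<nu>)"
    unfolding P_def by (rule refl_on_product_mod)
  from cofinality(1)[OF this] obtain C where C: "C \<subseteq> P"
    "\<forall>p\<in>P. \<exists>c\<in>C. (p, c) \<in> product_mod D X \<nu>" "cofinality P (product_mod D X \<nu>) = |C|"
    by (elim exE conjE) blast
  have "cofinality P (product_mod D X \<nu>) \<le>o hcf D \<theta> \<gamma>"
    unfolding hcf_eq X_def[symmetric] if_P[OF X]
  proof (rule card_sup(2))
    let ?R = "{cofinality (\<Pi>\<^sub>E i\<in>X. Field (\<nu> i)) (product_mod D X \<nu>) |\<nu>.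
        \<forall>i\<in>X. regular_cardinal (\<nu> i) \<and> \<theta> \<le>o \<nu> i \<and> \<nu> i \<le>o \<gamma> i}"
    show "cofinality P (product_mod D X \<nu>) \<in> ?R"
      unfolding P_def by (intro CollectI exI[of _ \<nu>] conjI refl ballI \<nu>)
    show "Card_order \<rho>" if "\<rho> \<in> ?R" for \<rho>
      using that by (elim CollectE exE conjE) (simp only: Card_order_cofinality_product_mod)
  qed
  then have "|C| \<le>o hcf D \<theta> \<gamma>"
    using C(3) by simp
  moreover have "\<exists>c\<in>C. \<forall>\<^sub>F i in D. i \<in> X \<longrightarrow> (p i, c i) \<in> \<nu> i" if "p \<in> P" for p
    using C(2) that by (auto simp: product_mod_def eventually_inf_principal)
  ultimately show thesis
    using C(1) that unfolding P_def by blast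
qed

text \<open>
  Singleton coordinates leave no choice. The others have regular cardinals in the range admitted by
  \<open>hcf\<close>, but they need not be all the coordinates that \<open>hcf\<close> counts, so the sequence of regular
  cardinals is filled up arbitrarily before taking a cofinal family, and the family is cut back afterwards. If \<open>hcf\<close>
  counts no positive set of coordinates, then almost all coordinates are singletons and one
  function suffices.
\<close>

lemma cofinal_choices_modulo_filter:
  fixes D :: "'k filter" and \<Lambda> :: "'k \<Rightarrow> 'a rel" and \<theta> :: "'t rel"
  assumes \<Lambda>: "\<And>i. Card_order (\<Lambda> i)" and \<theta>: "Cinfinite \<theta>"
    and \<chi>: "Cinfinite \<chi>" "hcf D \<theta> \<Lambda> \<le>o \<chi>"
    and sub: "\<And>i. Q i \<subseteq> Field (\<Lambda> i)"
    and reg: "\<And>i. is_singleton (Q i) \<or> regular_cardinal (Restr (\<Lambda> i) (Q i)) \<and> \<theta> \<le>o Restr (\<Lambda> i) (Q i)"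
  obtains S where "|S| \<le>o \<chi>" and "\<And>c i. c \<in> S \<Longrightarrow> c i \<in> Q i"
    and "\<And>p. \<forall>\<^sub>F i in D. p i \<in> Q i \<Longrightarrow> \<exists>c\<in>S. \<forall>\<^sub>F i in D. (p i, c i) \<in> \<Lambda> i"
proof -
  have W: "Well_order (\<Lambda> i)" for i
    using \<Lambda> by (rule card_order_on_well_order_on)
  define X where "X = {i. \<exists>\<nu> :: 'a rel. regular_cardinal \<nu> \<and> \<theta> \<le>o \<nu> \<and> \<nu> \<le>o \<Lambda> i}"
  define Y where "Y = {i. regular_cardinal (Restr (\<Lambda> i) (Q i)) \<and> \<theta> \<le>o Restr (\<Lambda> i) (Q i)}"
  have F: "Field (Restr (\<Lambda> i) (Q i)) = Q i" for i
    by (rule Field_Restr_Well_order[OF W sub])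
  have le: "Restr (\<Lambda> i) (Q i) \<le>o \<Lambda> i" if "i \<in> Y" for i
  proof -
    have "Card_order (Restr (\<Lambda> i) (Q i))"
      using that by (simp add: Y_def regular_cardinal_def)
    from card_of_Field_ordIso[OF this] have "Restr (\<Lambda> i) (Q i) =o |Q i|"
      unfolding F by (rule ordIso_symmetric)
    moreover have "|Q i| \<le>o |Field (\<Lambda> i)|"
      by (rule card_of_mono1[OF sub])
    moreover have "|Field (\<Lambda> i)| =o \<Lambda> i"
      by (rule card_of_Field_ordIso[OF \<Lambda>])
    ultimately show ?thesis
      by (meson ordIso_ordLeq_trans ordLeq_ordIso_trans)
  qed
  have YX: "Y \<subseteq> X"
    using le unfolding X_def Y_def by blast
  have nonempty: "Field \<nu> \<noteq> {}" if "\<theta> \<le>o \<nu>" for \<nu> :: "'a rel"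
  proof
    assume "Field \<nu> = {}"
    with card_of_mono2[OF that] have "|Field \<theta>| \<le>o |{} :: 'a set|" by simp
    then have "Field \<theta> = {}"
      using card_of_empty3 by blast
    with \<theta> show False
      by (simp add: cinfinite_def)
  qed
  have Qne: "Q i \<noteq> {}" for i
    using reg[of i] nonempty[of "Restr (\<Lambda> i) (Q i)"] F[of i] by (auto simp: is_singleton_def)
  define c0 where "c0 i = (SOME q. q \<in> Q i)" for i
  have c0: "c0 i \<in> Q i" for i
    unfolding c0_def using Qne by (simp add: some_in_eq)
  have single: "q = c0 i" if "q \<in> Q i" "i \<notin> Y" for q i
    using reg[of i] that c0[of i] by (auto simp: Y_def is_singleton_def)
  have rfl: "(q, q) \<in> \<Lambda> i" if "q \<in> Q i" for q i
    using Well_order_facts(1)[OF W] sub that by blast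
  show thesis
  proof (cases "\<exists>\<^sub>F i in D. i \<in> X")
    case False
    then have X: "\<forall>\<^sub>F i in D. i \<notin> X"
      by (simp add: frequently_def)
    show thesis
    proof (rule that[of "{c0}"])
      show "|{c0}| \<le>o \<chi>"
        using \<chi>(1) by (simp add: Cfinite_ordLess_Cinfinite cfinite_def Field_card_of
            card_of_card_order_on ordLess_imp_ordLeq)
      show "c i \<in> Q i" if "c \<in> {c0}" for c i
        using that c0 by simp
      show "\<exists>c\<in>{c0}. \<forall>\<^sub>F i in D. (p i, c i) \<in> \<Lambda> i" if "\<forall>\<^sub>F i in D. p i \<in> Q i" for p
      proof -
        have "\<forall>\<^sub>F i in D. (p i, c0 i) \<in> \<Lambda> i"
          using that X
        proof eventually_elim
          case (elim i)
          then have "p i = c0 i"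
            using single[of "p i" i] YX by blast
          with rfl[OF c0] show ?case by simp
        qed
        then show ?thesis by blast
      qed
    qed
  next
    case True
    have "\<exists>\<nu>. (regular_cardinal \<nu> \<and> \<theta> \<le>o \<nu> \<and> \<nu> \<le>o \<Lambda> i) \<and> (i \<in> Y \<longrightarrow> \<nu> = Restr (\<Lambda> i) (Q i))"
      if "i \<in> X" for i
    proof (cases "i \<in> Y")
      case True
      then show ?thesis using le[OF True] by (simp add: Y_def)
    next
      case False
      then show ?thesis using that by (simp add: X_def)
    qed
    then obtain \<nu> where
      \<nu>: "\<And>i. i \<in> X \<Longrightarrow> regular_cardinal (\<nu> i) \<and> \<theta> \<le>o \<nu> i \<and> \<nu> i \<le>o \<Lambda> i"
      and \<nu>Y: "\<And>i. i \<in> Y \<Longrightarrow> \<nu> i = Restr (\<Lambda> i) (Q i)"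
      using YX by (metis subsetD)
    obtain C where C: "C \<subseteq> (\<Pi>\<^sub>E i\<in>X. Field (\<nu> i))" "|C| \<le>o hcf D \<theta> \<Lambda>"
      "\<And>p. p \<in> (\<Pi>\<^sub>E i\<in>X. Field (\<nu> i)) \<Longrightarrow>
        \<exists>c\<in>C. \<forall>\<^sub>F i in D. i \<in> X \<longrightarrow> (p i, c i) \<in> \<nu> i"
      using True \<nu> unfolding X_def by (rule cofinal_family_le_hcf) blast+
    define ext where "ext c i = (if i \<in> Y then c i else c0 i)" for c :: "'k \<Rightarrow> 'a" and i
    show thesis
    proof (rule that[of "ext ` C"])
      show "|ext ` C| \<le>o \<chi>"
        using card_of_image C(2) \<chi>(2) by (meson ordLeq_transitive)
      show "c i \<in> Q i" if "c \<in> ext ` C" for c i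
      proof (cases "i \<in> Y")
        case True
        obtain d where d: "d \<in> C" "c = ext d"
          using \<open>c \<in> ext ` C\<close> by blast
        then have "d i \<in> Field (\<nu> i)"
          using C(1) True YX by blast
        then show ?thesis
          using d(2) True \<nu>Y F by (simp add: ext_def)
      next
        case False
        then show ?thesis
          using that c0 by (auto simp: ext_def)
      qed
      show "\<exists>c\<in>ext ` C. \<forall>\<^sub>F i in D. (p i, c i) \<in> \<Lambda> i" if p: "\<forall>\<^sub>F i in D. p i \<in> Q i" for p
      proof -
        define p' where "p' i = (if i \<in> X then if i \<in> Y \<and> p i \<in> Q i then p i
          else (SOME q. q \<in> Field (\<nu> i)) else undefined)" for i
        have "(SOME q. q \<in> Field (\<nu> i)) \<in> Field (\<nu> i)" if "i \<in> X" for i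
          using nonempty \<nu>[OF that] by (simp add: some_in_eq)
        then have "p' \<in> (\<Pi>\<^sub>E i\<in>X. Field (\<nu> i))"
          using \<nu>Y F by (auto simp: p'_def)
        then obtain c where c: "c \<in> C" "\<forall>\<^sub>F i in D. i \<in> X \<longrightarrow> (p' i, c i) \<in> \<nu> i"
          using C(3) by blast
        have "\<forall>\<^sub>F i in D. (p i, ext c i) \<in> \<Lambda> i"
          using p c(2)
        proof eventually_elim
          case (elim i)
          show ?case
          proof (cases "i \<in> Y")
            case True
            then have "(p' i, c i) \<in> \<nu> i" "p' i = p i"
              using elim YX by (auto simp: p'_def)
            then show ?thesis
              using \<nu>Y[OF True] True by (simp add: ext_def)
          next
            case False
            then have "p i = c0 i"
              using single elim by blast
            then show ?thesis
              using False rfl[OF c0] by (simp add: ext_def)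
          qed
        qed
        then show ?thesis
          using c(1) by blast
      qed
    qed
  qed
qed

section \<open>Sharper and sharper upper bounds\<close>

text \<open>
  \<open>H\<close> is the set of earlier upper bounds. A bound \<open>h\<close> may be wrong at a coordinate, as bounds hold only
  modulo \<open>D\<close>; hence only those \<open>h\<close> with \<open>f i \<le> h i\<close> have to be improved at \<open>i\<close>.
\<close>

definition sharpens :: "'k filter \<Rightarrow> ('k \<Rightarrow> 'a rel) \<Rightarrow> ('k \<Rightarrow> 'a) set \<Rightarrow> ('k \<Rightarrow> 'a) \<Rightarrow> ('k \<Rightarrow> 'a) \<Rightarrow> bool"
  where "sharpens D \<Lambda> H f g \<longleftrightarrow>
    (\<forall>\<^sub>F i in D. (f i, g i) \<in> \<Lambda> i \<and>
      (f i = g i \<or> (\<forall>h\<in>H. (f i, h i) \<in> \<Lambda> i \<longrightarrow> (g i, h i) \<in> \<Lambda> i \<and> g i \<noteq> h i)))"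

text \<open>
  First choose a set of options \<open>q i\<close> at every coordinate, up to equality modulo \<open>D\<close>; there are at most
  \<open>|\<theta>\<^sup>\<kappa>/D|\<close> such choices. Then, for each \<open>q\<close>, take a family of functions that is cofinal in
  the product of the \<open>q i\<close>.
\<close>

lemma few_sharpenings:
  fixes D :: "'k filter" and \<Lambda> :: "'k \<Rightarrow> 'a rel" and \<theta> :: "'t rel"
  assumes \<Lambda>: "\<And>i. Card_order (\<Lambda> i)" and \<theta>: "Cinfinite \<theta>"
    and \<chi>: "Cinfinite \<chi>" "hcf D \<theta> \<Lambda> \<le>o \<chi>" "|reduced_product D (\<lambda>i. Field \<theta>)| \<le>o \<chi>"
    and H: "|H| \<le>o \<theta>"
  shows "\<exists>S. |S| \<le>o \<chi> \<and> (\<forall>f. (\<forall>i. f i \<in> Field (\<Lambda> i)) \<longrightarrow> (\<exists>g\<in>S. sharpens D \<Lambda> H f g))"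
proof -
  define guesses where "guesses i \<Q> \<longleftrightarrow> |\<Q>| \<le>o \<theta> \<and> (\<forall>Q\<in>\<Q>. Q \<subseteq> Field (\<Lambda> i)) \<and>
      (\<forall>Q\<in>\<Q>. is_singleton Q \<or> regular_cardinal (Restr (\<Lambda> i) Q) \<and> \<theta> \<le>o Restr (\<Lambda> i) Q) \<and>
      (\<forall>x\<in>Field (\<Lambda> i). \<exists>Q\<in>\<Q>. \<exists>p\<in>Q. \<forall>c\<in>Q. (p, c) \<in> \<Lambda> i \<longrightarrow>
        (x, c) \<in> \<Lambda> i \<and> (x = c \<or> (\<forall>h\<in>H. (x, h i) \<in> \<Lambda> i \<longrightarrow> (c, h i) \<in> \<Lambda> i \<and> c \<noteq> h i)))"
    for i and \<Q> :: "'a set set"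
  have "\<exists>\<Q>. guesses i \<Q>" for i
  proof -
    have "|(\<lambda>h. h i) ` H| \<le>o \<theta>"
      using card_of_image H by (rule ordLeq_transitive)
    then show ?thesis
    proof (rule regular_or_singleton_family[OF \<Lambda>[of i] \<theta>])
      fix \<Q> :: "'a set set"
      assume 1: "|\<Q>| \<le>o \<theta>" and 2: "\<And>Q. Q \<in> \<Q> \<Longrightarrow> Q \<subseteq> Field (\<Lambda> i)"
        and 3: "\<And>Q. Q \<in> \<Q> \<Longrightarrow>
          is_singleton Q \<or> regular_cardinal (Restr (\<Lambda> i) Q) \<and> \<theta> \<le>o Restr (\<Lambda> i) Q"
        and 4: "\<And>x. x \<in> Field (\<Lambda> i) \<Longrightarrow> \<exists>Q\<in>\<Q>. \<exists>p\<in>Q. \<forall>c\<in>Q. (p, c) \<in> \<Lambda> i \<longrightarrow>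
          (x, c) \<in> \<Lambda> i \<and> (x = c \<or> (\<forall>b\<in>(\<lambda>h. h i) ` H. (x, b) \<in> \<Lambda> i \<longrightarrow> (c, b) \<in> \<Lambda> i \<and> c \<noteq> b))"
      have "guesses i \<Q>"
        unfolding guesses_def
        by (intro conjI ballI 1 2 3 4[unfolded ball_simps])
      then show ?thesis ..
    qed
  qed
  then obtain \<Q> where guesses: "\<And>i. guesses i (\<Q> i)"
    by metis
  then have \<Q>: "|\<Q> i| \<le>o \<theta>" "Q \<in> \<Q> i \<Longrightarrow> Q \<subseteq> Field (\<Lambda> i)"
    "Q \<in> \<Q> i \<Longrightarrow> is_singleton Q \<or> regular_cardinal (Restr (\<Lambda> i) Q) \<and> \<theta> \<le>o Restr (\<Lambda> i) Q" for i Q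
    unfolding guesses_def by simp_all
  obtain R where R: "\<And>q i. q \<in> R \<Longrightarrow> q i \<in> \<Q> i"
    "\<And>q q'. q \<in> R \<Longrightarrow> q' \<in> R \<Longrightarrow> \<forall>\<^sub>F i in D. q i = q' i \<Longrightarrow> q = q'"
    "\<And>q. (\<And>i. q i \<in> \<Q> i) \<Longrightarrow> \<exists>q'\<in>R. \<forall>\<^sub>F i in D. q i = q' i"
    "|reduced_product D \<Q>| \<le>o |R|"
    by (rule reduced_product_representatives[of \<Q> D]) blast
  have "|R| \<le>o |reduced_product D \<Q>|"
    using R(1,2) by (rule card_of_inequivalent_le_reduced_product)
  moreover have "|reduced_product D \<Q>| \<le>o |reduced_product D (\<lambda>i. Field \<theta>)|"
  proof (rule reduced_product_mono)
    show "|\<Q> i| \<le>o |Field \<theta>|" for i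
      using \<Q>(1) card_of_Field_ordIso[OF conjunct2[OF \<theta>]]
      by (meson ordIso_symmetric ordLeq_ordIso_trans)
  qed
  ultimately have R\<chi>: "|R| \<le>o \<chi>"
    using \<chi>(3) by (meson ordLeq_transitive)
  define covers where "covers q S \<longleftrightarrow> |S| \<le>o \<chi> \<and> (\<forall>c\<in>S. \<forall>i. c i \<in> q i) \<and>
      (\<forall>p. (\<forall>\<^sub>F i in D. p i \<in> q i) \<longrightarrow> (\<exists>c\<in>S. \<forall>\<^sub>F i in D. (p i, c i) \<in> \<Lambda> i))"
    for q :: "'k \<Rightarrow> 'a set" and S
  have "\<exists>S. covers q S" if q: "q \<in> R" for q
    using \<Lambda> \<theta> \<chi>(1,2)
  proof (rule cofinal_choices_modulo_filter)
    show "q i \<subseteq> Field (\<Lambda> i)" for i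
      by (rule \<Q>(2)[OF R(1)[OF q]])
    show "is_singleton (q i) \<or>
        regular_cardinal (Restr (\<Lambda> i) (q i)) \<and> \<theta> \<le>o Restr (\<Lambda> i) (q i)" for i
      by (rule \<Q>(3)[OF R(1)[OF q]])
  qed (auto simp: covers_def)
  then obtain S where "\<And>q. q \<in> R \<Longrightarrow> covers q (S q)"
    by metis
  then have S: "q \<in> R \<Longrightarrow> |S q| \<le>o \<chi>" "q \<in> R \<Longrightarrow> c \<in> S q \<Longrightarrow> c i \<in> q i"
    "q \<in> R \<Longrightarrow> \<forall>\<^sub>F i in D. p i \<in> q i \<Longrightarrow> \<exists>c\<in>S q. \<forall>\<^sub>F i in D. (p i, c i) \<in> \<Lambda> i" for q c i p
    unfolding covers_def by simp_all
  have "|\<Union>q\<in>R. S q| \<le>o \<chi>"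
    using R\<chi> S(1) \<chi>(1) by (intro UNION_Cinfinite_bound) auto
  moreover have "\<exists>g\<in>\<Union>q\<in>R. S q. sharpens D \<Lambda> H f g" if f: "\<And>i. f i \<in> Field (\<Lambda> i)" for f
  proof -
    define hits where "hits i Q p \<longleftrightarrow> (\<forall>c\<in>Q. (p, c) \<in> \<Lambda> i \<longrightarrow>
        (f i, c) \<in> \<Lambda> i \<and> (f i = c \<or> (\<forall>h\<in>H. (f i, h i) \<in> \<Lambda> i \<longrightarrow> (c, h i) \<in> \<Lambda> i \<and> c \<noteq> h i)))"
      for i Q p
    have "\<exists>Q p. Q \<in> \<Q> i \<and> p \<in> Q \<and> hits i Q p" for i
    proof -
      have "\<exists>Q\<in>\<Q> i. \<exists>p\<in>Q. hits i Q p"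
        using guesses[of i] f[of i] unfolding guesses_def hits_def by (elim conjE) (erule bspec)
      then show ?thesis by blast
    qed
    then obtain Q p where Q: "\<And>i. Q i \<in> \<Q> i" "\<And>i. p i \<in> Q i" "\<And>i. hits i (Q i) (p i)"
      by metis
    obtain q where q: "q \<in> R" "\<forall>\<^sub>F i in D. Q i = q i"
      using R(3)[of Q, OF Q(1)] by blast
    from q(2) have "\<forall>\<^sub>F i in D. p i \<in> q i"
    proof eventually_elim
      case (elim i)
      with Q(2)[of i] show ?case by simp
    qed
    then obtain g where g: "g \<in> S q" "\<forall>\<^sub>F i in D. (p i, g i) \<in> \<Lambda> i"
      using S(3)[OF q(1)] by blast
    have "sharpens D \<Lambda> H f g"
      unfolding sharpens_def using g(2) q(2)
    proof eventually_elim
      case (elim i)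
      have "g i \<in> Q i"
        using S(2)[OF q(1) g(1), of i] elim(2) by simp
      with Q(3)[of i] elim(1) show ?case
        unfolding hits_def by blast
    qed
    with g(1) q(1) show ?thesis by blast
  qed
  ultimately show ?thesis by blast
qed

section \<open>Termination of the search\<close>

text \<open>
  A set of indices along which values in a well-order strictly decrease is well-ordered in both
  directions.
\<close>

lemma finite_if_descending:
  assumes s: "Well_order s" and r: "Well_order r" and Z: "Z \<subseteq> Field s"
    and desc: "\<And>\<epsilon> \<zeta>. \<epsilon> \<in> Z \<Longrightarrow> \<zeta> \<in> Z \<Longrightarrow> (\<epsilon>, \<zeta>) \<in> s \<Longrightarrow> \<epsilon> \<noteq> \<zeta> \<Longrightarrow> (v \<zeta>, v \<epsilon>) \<in> r - Id"
  shows "finite Z"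
proof -
  have step: "finite Y" if "Y \<subseteq> Z" and IH: "\<And>\<epsilon>. \<epsilon> \<in> Y \<Longrightarrow> finite {\<zeta> \<in> Z. (v \<zeta>, v \<epsilon>) \<in> r - Id}" for Y
  proof (cases "Y = {}")
    case False
    have YF: "Y \<subseteq> Field s"
      using that(1) Z by (rule subset_trans)
    obtain \<epsilon> where \<epsilon>: "\<epsilon> \<in> Y" "\<And>\<zeta>. \<zeta> \<in> Y \<Longrightarrow> (\<epsilon>, \<zeta>) \<in> s"
      by (rule Well_order_has_least[OF s YF False]) blast
    have "Y \<subseteq> insert \<epsilon> {\<zeta> \<in> Z. (v \<zeta>, v \<epsilon>) \<in> r - Id}"
    proof
      fix \<zeta> assume "\<zeta> \<in> Y"
      then show "\<zeta> \<in> insert \<epsilon> {\<zeta> \<in> Z. (v \<zeta>, v \<epsilon>) \<in> r - Id}"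
        using desc[of \<epsilon> \<zeta>] \<epsilon> that(1) by (cases "\<zeta> = \<epsilon>") auto
    qed
    then show ?thesis
      using IH[OF \<epsilon>(1)] finite_subset by blast
  qed simp
  have "finite {\<zeta> \<in> Z. (v \<zeta>, y) \<in> r - Id}" for y
    using Well_order_facts(7)[OF r]
  proof (induction y rule: wf_induct_rule)
    case (less y)
    show ?case
      by (rule step) (use less in auto)
  qed
  then show ?thesis
    using step[of Z] by blast
qed

lemma reg_otimes_seq_shorten:
  assumes \<rho>: "\<rho> \<le>o \<theta>" and A: "reg_otimes_seq D \<theta> A"
  shows "\<exists>A. reg_otimes_seq D \<rho> A"
proof -
  obtain f where W: "Well_order \<rho>" "Well_order \<theta>" and f: "embed \<rho> \<theta> f"
    using \<rho> unfolding ordLeq_def by auto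
  have F: "f \<epsilon> \<in> Field \<theta>" if "\<epsilon> \<in> Field \<rho>" for \<epsilon>
    using embed_in_Field[OF f that] .
  have inj: "inj_on f (Field \<rho>)"
    by (rule embed_inj_on[OF W(1) f])
  have mono: "(f \<epsilon>, f \<zeta>) \<in> \<theta>" if "(\<epsilon>, \<zeta>) \<in> \<rho>" for \<epsilon> \<zeta>
    using embed_compat[OF f] that by (simp add: compat_def)
  have "reg_otimes_seq D \<rho> (\<lambda>\<epsilon>. A (f \<epsilon>))"
    unfolding reg_otimes_seq_def
  proof (intro conjI allI ballI impI)
    fix \<epsilon> assume "\<epsilon> \<in> Field \<rho>"
    then show "\<exists>\<^sub>F i in D. i \<in> A (f \<epsilon>)"
      using A F by (simp add: reg_otimes_seq_def)
  next
    fix \<epsilon> \<zeta> assume *: "(\<epsilon>, \<zeta>) \<in> \<rho> \<and> \<epsilon> \<noteq> \<zeta>"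
    then have "\<epsilon> \<in> Field \<rho>" "\<zeta> \<in> Field \<rho>"
      by (auto simp: Field_def)
    then have "f \<epsilon> \<noteq> f \<zeta>"
      using inj_onD[OF inj] * by auto
    then show "\<forall>\<^sub>F i in D. i \<notin> A (f \<zeta>) - A (f \<epsilon>)"
      using A mono * unfolding reg_otimes_seq_def by simp
  next
    fix i
    have "f ` {\<epsilon> \<in> Field \<rho>. i \<in> A (f \<epsilon>)} \<subseteq> {\<epsilon> \<in> Field \<theta>. i \<in> A \<epsilon>}"
      using F by auto
    moreover have "finite {\<epsilon> \<in> Field \<theta>. i \<in> A \<epsilon>}"
      using A by (simp add: reg_otimes_seq_def)
    moreover have "inj_on f {\<epsilon> \<in> Field \<rho>. i \<in> A (f \<epsilon>)}"
      by (rule inj_on_subset[OF inj]) auto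
    ultimately show "finite {\<epsilon> \<in> Field \<rho>. i \<in> A (f \<epsilon>)}"
      by (meson finite_imageD finite_subset)
  qed
  then show ?thesis by blast
qed

lemma no_reg_otimes_seq:
  fixes D :: "'k filter"
  assumes "infinite (UNIV :: 'k set)" and "reg_otimes D \<le>o \<theta>"
  shows "\<not> reg_otimes_seq D \<theta> A"
  using reg_otimes_seq_shorten[OF assms(2)] reg_otimes(2)[OF assms(1)] by blast

text \<open>
  For a finite index set the constant sequence \<open>\<kappa>\<close> is a witness.
\<close>

lemma infinite_if_no_reg_otimes_seq:
  assumes "D \<noteq> bot" and "\<And>A. \<not> reg_otimes_seq D \<theta> A"
  shows "infinite (Field \<theta>)"
proof
  assume "finite (Field \<theta>)"
  then have "reg_otimes_seq D \<theta> (\<lambda>_. UNIV)"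
    using assms(1) by (simp add: reg_otimes_seq_def)
  with assms(2) show False by blast
qed

text \<open>
  The sets \<open>{i. f i < g \<epsilon> i}\<close> would contradict \<open>no_seq\<close>. Exceptional points of the filter could still
  lie in infinitely many of them, so each set is first reduced, by a null set, to the points where \<open>g \<epsilon>\<close>
  is indeed below all relevant earlier values.
\<close>

lemma sharpening_terminates:
  fixes \<theta> :: "'t rel" and g :: "'t \<Rightarrow> 'k \<Rightarrow> 'a"
  assumes \<theta>: "Well_order \<theta>" and \<Lambda>: "\<And>i. Well_order (\<Lambda> i)"
    and no_seq: "\<And>A. \<not> reg_otimes_seq D \<theta> A"
    and g: "\<And>\<epsilon>. \<epsilon> \<in> Field \<theta> \<Longrightarrow> sharpens D \<Lambda> (g ` underS \<theta> \<epsilon>) f (g \<epsilon>)"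
  shows "\<exists>\<epsilon>\<in>Field \<theta>. \<forall>\<^sub>F i in D. f i = g \<epsilon> i"
proof (rule ccontr)
  assume never: "\<not> ?thesis"
  define below where "below \<epsilon> i \<longleftrightarrow> (\<forall>\<xi>\<in>underS \<theta> \<epsilon>. (f i, g \<xi> i) \<in> \<Lambda> i \<longrightarrow>
    (g \<epsilon> i, g \<xi> i) \<in> \<Lambda> i \<and> g \<epsilon> i \<noteq> g \<xi> i)" for \<epsilon> i
  define A where "A \<epsilon> = {i. f i \<noteq> g \<epsilon> i \<and> (f i, g \<epsilon> i) \<in> \<Lambda> i \<and> below \<epsilon> i}" for \<epsilon>
  have g': "\<forall>\<^sub>F i in D. (f i, g \<epsilon> i) \<in> \<Lambda> i \<and> (f i = g \<epsilon> i \<or> below \<epsilon> i)" if "\<epsilon> \<in> Field \<theta>" for \<epsilon>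
    using g[OF that] by (simp add: sharpens_def below_def)
  have "reg_otimes_seq D \<theta> A"
    unfolding reg_otimes_seq_def
  proof (intro conjI allI ballI impI)
    fix \<epsilon> assume \<epsilon>: "\<epsilon> \<in> Field \<theta>"
    then have "\<exists>\<^sub>F i in D. f i \<noteq> g \<epsilon> i"
      using never by (simp add: frequently_def)
    from frequently_eventually_frequently[OF this g'[OF \<epsilon>]]
    show "\<exists>\<^sub>F i in D. i \<in> A \<epsilon>"
      by (rule frequently_elim1) (auto simp: A_def)
  next
    fix \<epsilon> \<zeta> assume *: "(\<epsilon>, \<zeta>) \<in> \<theta> \<and> \<epsilon> \<noteq> \<zeta>"
    then have u: "\<epsilon> \<in> underS \<theta> \<zeta>" and "\<epsilon> \<in> Field \<theta>"
      by (auto simp: underS_def Field_def)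
    from g'[OF this(2)] show "\<forall>\<^sub>F i in D. i \<notin> A \<zeta> - A \<epsilon>"
    proof eventually_elim
      case (elim i)
      have "f i \<noteq> g \<epsilon> i" if "i \<in> A \<zeta>"
      proof
        assume "f i = g \<epsilon> i"
        moreover have "(g \<zeta> i, g \<epsilon> i) \<in> \<Lambda> i" "g \<zeta> i \<noteq> g \<epsilon> i" "(f i, g \<zeta> i) \<in> \<Lambda> i"
          using that u elim by (auto simp: A_def below_def)
        ultimately show False
          using Well_order_facts(3)[OF \<Lambda>, of "f i" "g \<zeta> i" i] by simp
      qed
      then show ?case
        using elim by (auto simp: A_def)
    qed
  next
    fix i
    show "finite {\<epsilon> \<in> Field \<theta>. i \<in> A \<epsilon>}"
    proof (rule finite_if_descending[OF \<theta> \<Lambda>[of i]])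
      fix \<epsilon> \<zeta> assume *: "\<epsilon> \<in> {\<epsilon> \<in> Field \<theta>. i \<in> A \<epsilon>}" "\<zeta> \<in> {\<epsilon> \<in> Field \<theta>. i \<in> A \<epsilon>}"
        "(\<epsilon>, \<zeta>) \<in> \<theta>" "\<epsilon> \<noteq> \<zeta>"
      then have "\<epsilon> \<in> underS \<theta> \<zeta>"
        by (simp add: underS_def)
      with * show "(g \<zeta> i, g \<epsilon> i) \<in> \<Lambda> i - Id"
        by (auto simp: A_def below_def)
    qed auto
  qed
  with no_seq show False by blast
qed

section \<open>Counting the runs of the search\<close>

lemma card_of_image_underS_le:
  assumes "Card_order \<theta>"
  shows "|h ` underS \<theta> \<epsilon>| \<le>o \<theta>"
proof -
  have "|h ` underS \<theta> \<epsilon>| \<le>o |underS \<theta> \<epsilon>|"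
    by (rule card_of_image)
  also have "|underS \<theta> \<epsilon>| \<le>o |Field \<theta>|"
    by (rule card_of_mono1) (auto simp: underS_def Field_def)
  also have "|Field \<theta>| =o \<theta>"
    by (rule card_of_Field_ordIso[OF assms])
  finally show ?thesis .
qed

lemma weak_power_bounds:
  fixes \<chi> :: "'b rel" and \<theta> :: "'t rel" and A :: "'t set"
  shows "Card_order (weak_power \<chi> \<theta>)"
    and "|A| <o \<theta> \<Longrightarrow> |Func A (Field \<chi>)| \<le>o weak_power \<chi> \<theta>"
proof -
  have Co: "Card_order \<rho>" if "\<rho> \<in> {\<chi> ^c \<sigma> |\<sigma> :: 't rel. Card_order \<sigma> \<and> \<sigma> <o \<theta>}" for \<rho>
    using that Card_order_cexp by blast
  show "Card_order (weak_power \<chi> \<theta>)"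
    unfolding weak_power_def using Co by (rule card_sup(1))
  assume "|A| <o \<theta>"
  then have mem: "\<chi> ^c |A| \<in> {\<chi> ^c \<sigma> |\<sigma> :: 't rel. Card_order \<sigma> \<and> \<sigma> <o \<theta>}"
    using card_of_Card_order by blast
  have "\<chi> ^c |A| \<le>o weak_power \<chi> \<theta>"
    unfolding weak_power_def using Co mem by (rule card_sup(2))
  then show "|Func A (Field \<chi>)| \<le>o weak_power \<chi> \<theta>"
    by (simp add: cexp_def Field_card_of)
qed

lemma card_of_under_ordLess:
  assumes "Cinfinite \<theta>" and "\<epsilon> \<in> Field \<theta>"
  shows "|under \<theta> \<epsilon>| <o \<theta>"
proof -
  have co: "Card_order \<theta>" and inf: "infinite (Field \<theta>)"
    using assms(1) by (auto simp: cinfinite_def)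
  obtain \<zeta> where \<zeta>: "\<zeta> \<in> Field \<theta>" "\<epsilon> \<noteq> \<zeta>" "(\<epsilon>, \<zeta>) \<in> \<theta>"
    using infinite_Card_order_limit[OF co inf assms(2)] by blast
  have "under \<theta> \<epsilon> \<subseteq> underS \<theta> \<zeta>"
    using \<zeta> Well_order_facts(2,3)[OF card_order_on_well_order_on[OF co]]
    unfolding under_def underS_def by (metis (mono_tags, lifting) mem_Collect_eq subsetI)
  then show ?thesis
    using card_of_mono1 card_of_underS[OF co \<zeta>(1)] by (meson ordLeq_ordLess_trans)
qed

text \<open>
  The counting principle behind the search. All the sets \<open>S H\<close> of outcomes are coded by elements
  of \<open>\<chi>\<close>. As the outcomes before a stage determine the set in which the next outcome lies, the codes up to
  \<open>stop f\<close> determine the run of the search, and there are fewer than \<open>\<theta>\<close> of them.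
\<close>

lemma card_of_le_weak_power_if_coded:
  fixes \<theta> :: "'t rel" and \<chi> :: "'b rel"
    and pick :: "'f \<Rightarrow> 'g set \<Rightarrow> 'g" and g :: "'f \<Rightarrow> 't \<Rightarrow> 'g" and stop :: "'f \<Rightarrow> 't"
  assumes \<theta>: "Cinfinite \<theta>" and \<chi>: "Cinfinite \<chi>" and le: "\<theta> \<le>o \<chi>"
    and S: "\<And>H. |H| \<le>o \<theta> \<Longrightarrow> |S H| \<le>o \<chi>"
    and pick: "\<And>f H. f \<in> F \<Longrightarrow> |H| \<le>o \<theta> \<Longrightarrow> pick f H \<in> S H"
    and g: "\<And>f \<epsilon>. g f \<epsilon> = pick f (g f ` underS \<theta> \<epsilon>)"
    and stop: "\<And>f. f \<in> F \<Longrightarrow> stop f \<in> Field \<theta>"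
    and det: "\<And>f f'. f \<in> F \<Longrightarrow> f' \<in> F \<Longrightarrow> stop f = stop f' \<Longrightarrow> g f (stop f) = g f' (stop f) \<Longrightarrow> f = f'"
  shows "|F| \<le>o weak_power \<chi> \<theta>"
proof -
  let ?\<mu> = "weak_power \<chi> \<theta>"
  have co: "Card_order \<theta>" "Card_order \<chi>"
    using \<theta> \<chi> by auto
  have W: "Well_order \<theta>"
    using co(1) by (rule card_order_on_well_order_on)
  have small: "|g f ` underS \<theta> \<epsilon>| \<le>o \<theta>" for f \<epsilon>
    by (rule card_of_image_underS_le[OF co(1)])
  have "\<exists>j. inj_on j (S H) \<and> j ` S H \<subseteq> Field \<chi>" if "|H| \<le>o \<theta>" for H
  proof -
    have "|S H| \<le>o |Field \<chi>|"
      using S[OF that] card_of_Field_ordIso[OF co(2)] by (meson ordIso_symmetric ordLeq_ordIso_trans)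
    then show ?thesis
      using card_of_ordLeq[of "S H" "Field \<chi>"] by simp
  qed
  then obtain j where j: "\<And>H. |H| \<le>o \<theta> \<Longrightarrow> inj_on (j H) (S H)"
    "\<And>H. |H| \<le>o \<theta> \<Longrightarrow> j H ` S H \<subseteq> Field \<chi>"
    by metis
  \<comment> \<open>the code is read relative to the earlier outcomes, which are recovered first\<close>
  define code where "code f \<epsilon> = j (g f ` underS \<theta> \<epsilon>) (g f \<epsilon>)" for f \<epsilon>
  define \<Phi> where "\<Phi> f = (stop f, \<lambda>\<xi>. if \<xi> \<in> under \<theta> (stop f) then code f \<xi> else undefined)" for f
  have inS: "g f \<epsilon> \<in> S (g f ` underS \<theta> \<epsilon>)" if "f \<in> F" for f \<epsilon>
    using pick[OF that small] g by metis
  have eq: "g f \<xi> = g f' \<xi>"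
    if f: "f \<in> F" "f' \<in> F" and c: "\<And>\<xi>. \<xi> \<in> under \<theta> \<epsilon> \<Longrightarrow> code f \<xi> = code f' \<xi>"
      and \<xi>: "\<xi> \<in> under \<theta> \<epsilon>" for f f' \<epsilon> \<xi>
    using Well_order_facts(7)[OF W] \<xi>
  proof (induction \<xi> rule: wf_induct_rule)
    case (less \<xi>)
    have "g f \<eta> = g f' \<eta>" if "\<eta> \<in> underS \<theta> \<xi>" for \<eta>
    proof (rule less.IH)
      show "(\<eta>, \<xi>) \<in> \<theta> - Id"
        using that by (simp add: underS_def)
      then show "\<eta> \<in> under \<theta> \<epsilon>"
        using less.prems Well_order_facts(2)[OF W] unfolding under_def by blast
    qed
    then have img: "g f ` underS \<theta> \<xi> = g f' ` underS \<theta> \<xi>"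
      by (auto intro!: image_cong)
    show ?case
    proof (rule inj_onD[OF j(1)[OF small]])
      show "j (g f ` underS \<theta> \<xi>) (g f \<xi>) = j (g f ` underS \<theta> \<xi>) (g f' \<xi>)"
        using c[OF less.prems] unfolding code_def img[symmetric] .
      show "g f \<xi> \<in> S (g f ` underS \<theta> \<xi>)"
        by (rule inS[OF f(1)])
      show "g f' \<xi> \<in> S (g f ` underS \<theta> \<xi>)"
        unfolding img by (rule inS[OF f(2)])
    qed
  qed
  have inj: "inj_on \<Phi> F"
  proof (rule inj_onI)
    fix f f' assume f: "f \<in> F" "f' \<in> F" and \<Phi>: "\<Phi> f = \<Phi> f'"
    have s: "stop f = stop f'"
      using \<Phi> by (simp add: \<Phi>_def)
    have c: "code f \<xi> = code f' \<xi>" if "\<xi> \<in> under \<theta> (stop f)" for \<xi>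
      using fun_cong[OF arg_cong[OF \<Phi>, of snd], of \<xi>] that s by (simp add: \<Phi>_def)
    have "stop f \<in> under \<theta> (stop f)"
      using Well_order_facts(1)[OF W stop[OF f(1)]] by (simp add: under_def)
    from eq[OF f c this] have "g f (stop f) = g f' (stop f)" by blast
    with det[OF f s] show "f = f'" by blast
  qed
  let ?T = "SIGMA \<epsilon>:Field \<theta>. Func (under \<theta> \<epsilon>) (Field \<chi>)"
  have "code f \<xi> \<in> Field \<chi>" if "f \<in> F" for f \<xi>
    using j(2)[OF small] inS[OF that] unfolding code_def by blast
  then have range: "\<Phi> ` F \<subseteq> ?T"
    using stop by (auto simp: \<Phi>_def Func_def)
  have F_le: "|F| \<le>o |?T|"
    using inj range by (meson card_of_ordLeqI image_subset_iff)
  have pow: "|Func (under \<theta> \<epsilon>) (Field \<chi>)| \<le>o ?\<mu>" if "\<epsilon> \<in> Field \<theta>" for \<epsilon>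
    by (rule weak_power_bounds(2)[OF card_of_under_ordLess[OF \<theta> that]])
  have \<chi>\<mu>: "\<chi> \<le>o ?\<mu>"
  proof -
    have "Field \<theta> \<noteq> {}"
      using \<theta> by (auto simp: cinfinite_def)
    then obtain \<epsilon> where \<epsilon>: "\<epsilon> \<in> Field \<theta>" by blast
    then have "\<epsilon> \<in> under \<theta> \<epsilon>"
      using Well_order_facts(1)[OF W] by (simp add: under_def)
    then have "Cnotzero |under \<theta> \<epsilon>|"
      by (auto simp: card_of_Card_order czero_def dest!: ordIso_imp_ordLeq card_of_empty3)
    from ordLeq_cexp1[OF this co(2)] have "\<chi> \<le>o |Func (under \<theta> \<epsilon>) (Field \<chi>)|"
      by (simp add: cexp_def Field_card_of)
    then show ?thesis
      using pow[OF \<epsilon>] by (rule ordLeq_transitive)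
  qed
  have "infinite (Field ?\<mu>)"
    using cinfinite_mono[OF \<chi>\<mu>] \<chi> by (simp add: cinfinite_def)
  moreover have "|Field \<theta>| \<le>o ?\<mu>"
    using card_of_Field_ordIso[OF co(1)] le \<chi>\<mu> by (meson ordIso_ordLeq_trans ordLeq_transitive)
  ultimately have "|?T| \<le>o ?\<mu>"
    using pow weak_power_bounds(1) by (intro card_of_Sigma_ordLeq_infinite_Field) auto
  with F_le show ?thesis
    by (rule ordLeq_transitive)
qed

section \<open>The cardinality of the reduced product\<close>

theorem lemma3p9:
  fixes D :: "'k filter"
    and \<Lambda> :: "'k \<Rightarrow> 'a rel"
    and \<theta> :: "'t rel"
  assumes "infinite (UNIV :: 'k set)"
    and "D \<noteq> bot"
    and "\<And>i. Card_order (\<Lambda> i)"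
    and "\<And>i. Field (\<Lambda> i) \<noteq> {}"
    and "Card_order \<theta>"
    and "reg_otimes D \<le>o \<theta>"
  shows "|reduced_product D (\<lambda>i. Field (\<Lambda> i))|
           \<le>o weak_power ( |reduced_product D (\<lambda>i. Field \<theta>)| +c hcf D \<theta> \<Lambda>) \<theta>"
proof -
  let ?\<chi> = "|reduced_product D (\<lambda>i. Field \<theta>)| +c hcf D \<theta> \<Lambda>"
  have W: "Well_order \<theta>" "\<And>i. Well_order (\<Lambda> i)"
    using assms(3,5) by (simp_all add: card_order_on_well_order_on)
  have no_seq: "\<And>A. \<not> reg_otimes_seq D \<theta> A"
    using assms(1,6) by (rule no_reg_otimes_seq)
  have \<theta>: "Cinfinite \<theta>"
    using infinite_if_no_reg_otimes_seq[OF assms(2) no_seq] assms(5) by (simp add: cinfinite_def)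
  have "\<theta> =o |Field \<theta>|"
    using card_of_Field_ordIso[OF assms(5)] by (rule ordIso_symmetric)
  moreover have power: "|reduced_product D (\<lambda>i. Field \<theta>)| \<le>o ?\<chi>"
    by (rule ordLeq_csum1[OF card_of_Card_order])
  ultimately have \<theta>\<chi>: "\<theta> \<le>o ?\<chi>"
    using le_reduced_power[OF assms(2), of "Field \<theta>"] by (meson ordIso_ordLeq_trans ordLeq_transitive)
  have \<chi>: "Cinfinite ?\<chi>"
    using cinfinite_mono[OF \<theta>\<chi>] \<theta> Card_order_csum by blast
  have hcf: "hcf D \<theta> \<Lambda> \<le>o ?\<chi>"
    by (rule ordLeq_csum2[OF Card_order_hcf])
  obtain F where F: "\<And>f i. f \<in> F \<Longrightarrow> f i \<in> Field (\<Lambda> i)"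
    "\<And>f f'. f \<in> F \<Longrightarrow> f' \<in> F \<Longrightarrow> \<forall>\<^sub>F i in D. f i = f' i \<Longrightarrow> f = f'"
    "\<And>f. (\<And>i. f i \<in> Field (\<Lambda> i)) \<Longrightarrow> \<exists>f'\<in>F. \<forall>\<^sub>F i in D. f i = f' i"
    "|reduced_product D (\<lambda>i. Field (\<Lambda> i))| \<le>o |F|"
    by (rule reduced_product_representatives[of "\<lambda>i. Field (\<Lambda> i)" D]) blast
  obtain S where S: "\<And>H. |H| \<le>o \<theta> \<Longrightarrow> |S H| \<le>o ?\<chi>"
    "\<And>H f. |H| \<le>o \<theta> \<Longrightarrow> \<forall>i. f i \<in> Field (\<Lambda> i) \<Longrightarrow> \<exists>g\<in>S H. sharpens D \<Lambda> H f g"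
    using few_sharpenings[OF assms(3) \<theta> \<chi> hcf power] by metis
  \<comment> \<open>the choice depends on f; the set S H from which it is made does not\<close>
  define pick where "pick f H = (SOME g. g \<in> S H \<and> sharpens D \<Lambda> H f g)" for f H
  have pick: "pick f H \<in> S H \<and> sharpens D \<Lambda> H f (pick f H)" if "f \<in> F" "|H| \<le>o \<theta>" for f H
  proof -
    have "\<forall>i. f i \<in> Field (\<Lambda> i)"
      using F(1) that(1) by simp
    then have "\<exists>g. g \<in> S H \<and> sharpens D \<Lambda> H f g"
      using S(2)[OF that(2), of f] by (simp add: Bex_def)
    then show ?thesis
      unfolding pick_def by (rule someI_ex)
  qed
  define g where "g f = wfrec (\<theta> - Id) (\<lambda>\<phi> \<epsilon>. pick f (\<phi> ` underS \<theta> \<epsilon>))" for f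
  have g: "g f \<epsilon> = pick f (g f ` underS \<theta> \<epsilon>)" for f \<epsilon>
  proof -
    have "cut (g f) (\<theta> - Id) \<epsilon> ` underS \<theta> \<epsilon> = g f ` underS \<theta> \<epsilon>"
      by (rule image_cong) (auto simp: underS_def cut_def)
    moreover have "g f \<epsilon> = pick f (cut (g f) (\<theta> - Id) \<epsilon> ` underS \<theta> \<epsilon>)"
      unfolding g_def by (rule wfrec[OF Well_order_facts(7)[OF W(1)]])
    ultimately show ?thesis by (simp only:)
  qed
  have few: "|g f ` underS \<theta> \<epsilon>| \<le>o \<theta>" for f \<epsilon>
    by (rule card_of_image_underS_le[OF assms(5)])
  have "\<exists>\<epsilon>\<in>Field \<theta>. \<forall>\<^sub>F i in D. f i = g f \<epsilon> i" if "f \<in> F" for f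
  proof (rule sharpening_terminates[OF W no_seq])
    show "sharpens D \<Lambda> (g f ` underS \<theta> \<epsilon>) f (g f \<epsilon>)" for \<epsilon>
      using pick[OF that few, of f \<epsilon>] by (simp only: g[of f \<epsilon>, symmetric])
  qed
  then obtain stop where stop: "\<And>f. f \<in> F \<Longrightarrow> stop f \<in> Field \<theta>"
    "\<And>f. f \<in> F \<Longrightarrow> \<forall>\<^sub>F i in D. f i = g f (stop f) i"
    by metis
  have "|F| \<le>o weak_power ?\<chi> \<theta>"
  proof (rule card_of_le_weak_power_if_coded[OF \<theta> \<chi> \<theta>\<chi> S(1)])
    show "pick f H \<in> S H" if "f \<in> F" "|H| \<le>o \<theta>" for f H
      using pick[OF that] by blast
    show "f = f'" if "f \<in> F" "f' \<in> F" "stop f = stop f'" "g f (stop f) = g f' (stop f)" for f f'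
    proof (rule F(2)[OF that(1,2)])
      show "\<forall>\<^sub>F i in D. f i = f' i"
        using stop(2)[OF that(1)] stop(2)[OF that(2)]
        by eventually_elim (use that(3,4) in simp)
    qed
  qed (assumption, rule g, erule stop(1))
  with F(4) show ?thesis
    by (rule ordLeq_transitive)
qed

end
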